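(* Let $\Bbbk$ be an algebraically closed field of positive characteristic. Then the rings of invariants $B_5^\theta$, $B_6^\theta$ and $B_7^\theta$ of the three locally finite iterative higher derivations $\theta$ on $B_5$, $B_6$, $B_7$ over $\Bbbk$ defined in the context are finitely generated $\Bbbk$-algebras.
   Context: For a $\Bbbk$-algebra $B$ and a $\Bbbk$-algebra homomorphism $\theta:B\to B[U]$ ($U$ an indeterminate), write $\theta(b)=\sum_{n\ge 0}\theta^{(n)}(b)U^n$. Then $\theta$ is called a locally finite iterative higher derivation (lfihd) if $\theta^{(0)}=\mathrm{id}_B$ and $\theta^{(j)}(\theta^{(k)}(b))=\binom{j+k}{j}\theta^{(j+k)}(b)$ for all $j,k\ge 0$, $b\in B$; these correspond to algebraic actions of the additive group $\mathbb{G}_a$ on $B$. The ring of invariants is $B^\theta=\{b\in B\mid \theta^{(n)}(b)=0 \text{ for all } n\ge 1\}=\{b\in B\mid\theta(b)=b\}$. The three examples, each a polynomial ring over $\Bbbk$ with a $\Bbbk$-algebra homomorphism $\theta$ (which is an lfihd) given on the variables: (DF5) $B_5=\Bbbk[x,s,t,u,v]$ with $\theta(x)=x$, $\theta(s)=s+x^3U$, $\theta(t)=t+2sU+x^3U^2$, $\theta(u)=u+3tU+3sU^2+x^3U^3$, $\theta(v)=v+x^2U$. (F6) $B_6=\Bbbk[x,y,s,t,u,v]$ with $\theta(x)=x$, $\theta(y)=y$, $\theta(s)=s+x^3U$, $\theta(t)=t+2y^3sU+x^3y^3U^2$, $\theta(u)=u+3y^3tU+3y^6sU^2+x^3y^6U^3$,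 $\theta(v)=v+x^2y^2U$. (R7) $B_7=\Bbbk[x_1,x_2,x_3,y_1,y_2,y_3,v]$ with $\theta(x_i)=x_i$, $\theta(y_i)=y_i+x_i^3U$ for $i=1,2,3$, and $\theta(v)=v+x_1^2x_2^2x_3^2U$. *)

theory Defs
  imports "HOL-Library.Poly_Mapping" "HOL-Computational_Algebra.Polynomial" "HOL.Hull"
begin

section \<open>Polynomial rings in variables indexed by a type\<close>

text \<open>
  The monoid algebra of \<open>'v \<Rightarrow>\<^sub>0 nat\<close> over \<open>'k\<close>, that is, the polynomial ring over \<open>'k\<close> with
  exactly one variable for each element of the type \<open>'v\<close>.
\<close>

type_synonym ('v, 'k) mpoly = "('v \<Rightarrow>\<^sub>0 nat) \<Rightarrow>\<^sub>0 'k"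

definition Const :: "'k::comm_ring_1 \<Rightarrow> ('v, 'k) mpoly" where
  "Const c = Poly_Mapping.single 0 c"

definition Var :: "'v \<Rightarrow> ('v, 'k::comm_ring_1) mpoly" where
  "Var v = Poly_Mapping.single (Poly_Mapping.single v 1) 1"

definition monom_val :: "('v \<Rightarrow> 'r::comm_ring_1) \<Rightarrow> ('v \<Rightarrow>\<^sub>0 nat) \<Rightarrow> 'r" where
  "monom_val f m = (\<Prod>v\<in>Poly_Mapping.keys m. f v ^ Poly_Mapping.lookup m v)"

definition aeval ::
  "('k::comm_ring_1 \<Rightarrow> 'r::comm_ring_1) \<Rightarrow> ('v \<Rightarrow> 'r) \<Rightarrow> ('v, 'k) mpoly \<Rightarrow> 'r" where
  "aeval h f p = (\<Sum>m\<in>Poly_Mapping.keys p. h (Poly_Mapping.lookup p m) * monom_val f m)"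

section \<open>Subalgebras and finite generation\<close>

definition subalgebra :: "('v, 'k::comm_ring_1) mpoly set \<Rightarrow> bool" where
  "subalgebra A \<longleftrightarrow> (\<forall>c. Const c \<in> A) \<and> (\<forall>a\<in>A. \<forall>b\<in>A. a + b \<in> A) \<and> (\<forall>a\<in>A. \<forall>b\<in>A. a * b \<in> A)"

text \<open>
  Closure under negation is automatic because \<open>Const (- 1)\<close> lies in every subalgebra.  The set
  \<open>subalgebra hull G\<close> is the smallest subalgebra containing \<open>G\<close>.
\<close>

definition fin_gen_algebra :: "('v, 'k::comm_ring_1) mpoly set \<Rightarrow> bool" where
  "fin_gen_algebra A \<longleftrightarrow> (\<exists>G. finite G \<and> subalgebra hull G = A)"

section \<open>Locally finite iterative higher derivations\<close>

text \<open>
  A map \<open>\<theta>\<close> from \<open>B\<close> to \<open>B[U]\<close>; the component \<open>\<theta>\<^sup>(\<^sup>n\<^sup>)\<close> is \<open>\<lambda>b. coeff (\<theta> b) n\<close>, and \<open>B[U]\<close> is a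
  \<open>'k\<close>-algebra via the constant polynomials \<open>[:Const c:]\<close>.
\<close>

definition alg_hom :: "(('v, 'k::comm_ring_1) mpoly \<Rightarrow> ('v, 'k) mpoly poly) \<Rightarrow> bool" where
  "alg_hom \<theta> \<longleftrightarrow> (\<forall>c. \<theta> (Const c) = [:Const c:]) \<and>
     (\<forall>a b. \<theta> (a + b) = \<theta> a + \<theta> b) \<and> (\<forall>a b. \<theta> (a * b) = \<theta> a * \<theta> b)"

definition lfihd :: "(('v, 'k::comm_ring_1) mpoly \<Rightarrow> ('v, 'k) mpoly poly) \<Rightarrow> bool" where
  "lfihd \<theta> \<longleftrightarrow> alg_hom \<theta> \<and> (\<forall>b. coeff (\<theta> b) 0 = b) \<and>
     (\<forall>j k b. coeff (\<theta> (coeff (\<theta> b) k)) j = of_nat ((j + k) choose j) * coeff (\<theta> b) (j + k))"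

definition invariants ::
  "(('v, 'k::comm_ring_1) mpoly \<Rightarrow> ('v, 'k) mpoly poly) \<Rightarrow> ('v, 'k) mpoly set" where
  "invariants \<theta> = {b. \<forall>n\<ge>1. coeff (\<theta> b) n = 0}"

text \<open>The \<open>'k\<close>-algebra homomorphism from \<open>B\<close> to \<open>B[U]\<close> with prescribed values on the variables.\<close>

definition hom_of_vars ::
  "('v \<Rightarrow> ('v, 'k::comm_ring_1) mpoly poly) \<Rightarrow> ('v, 'k) mpoly \<Rightarrow> ('v, 'k) mpoly poly" where
  "hom_of_vars f = aeval (\<lambda>c. [:Const c:]) f"

section \<open>The three examples\<close>

text \<open>
  A list \<open>[:a\<^sub>0, a\<^sub>1, \<dots>:]\<close> stands for the polynomial \<open>a\<^sub>0 + a\<^sub>1 U + \<dots>\<close> in \<open>B[U]\<close>.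
\<close>

datatype vars5 = X5 | S5 | T5 | U5 | V5

primrec img5 :: "vars5 \<Rightarrow> (vars5, 'k::comm_ring_1) mpoly poly" where
  "img5 X5 = [:Var X5:]"
| "img5 S5 = [:Var S5, Var X5 ^ 3:]"
| "img5 T5 = [:Var T5, 2 * Var S5, Var X5 ^ 3:]"
| "img5 U5 = [:Var U5, 3 * Var T5, 3 * Var S5, Var X5 ^ 3:]"
| "img5 V5 = [:Var V5, Var X5 ^ 2:]"

definition theta5 :: "(vars5, 'k::comm_ring_1) mpoly \<Rightarrow> (vars5, 'k) mpoly poly" where
  "theta5 = hom_of_vars img5"

datatype vars6 = X6 | Y6 | S6 | T6 | U6 | V6

primrec img6 :: "vars6 \<Rightarrow> (vars6, 'k::comm_ring_1) mpoly poly" where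
  "img6 X6 = [:Var X6:]"
| "img6 Y6 = [:Var Y6:]"
| "img6 S6 = [:Var S6, Var X6 ^ 3:]"
| "img6 T6 = [:Var T6, 2 * Var Y6 ^ 3 * Var S6, Var X6 ^ 3 * Var Y6 ^ 3:]"
| "img6 U6 = [:Var U6, 3 * Var Y6 ^ 3 * Var T6, 3 * Var Y6 ^ 6 * Var S6, Var X6 ^ 3 * Var Y6 ^ 6:]"
| "img6 V6 = [:Var V6, Var X6 ^ 2 * Var Y6 ^ 2:]"

definition theta6 :: "(vars6, 'k::comm_ring_1) mpoly \<Rightarrow> (vars6, 'k) mpoly poly" where
  "theta6 = hom_of_vars img6"

datatype index3 = I1 | I2 | I3

datatype vars7 = X7 index3 | Y7 index3 | V7

primrec img7 :: "vars7 \<Rightarrow> (vars7, 'k::comm_ring_1) mpoly poly" where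
  "img7 (X7 i) = [:Var (X7 i):]"
| "img7 (Y7 i) = [:Var (Y7 i), Var (X7 i) ^ 3:]"
| "img7 V7 = [:Var V7, Var (X7 I1) ^ 2 * Var (X7 I2) ^ 2 * Var (X7 I3) ^ 2:]"

definition theta7 :: "(vars7, 'k::comm_ring_1) mpoly \<Rightarrow> (vars7, 'k) mpoly poly" where
  "theta7 = hom_of_vars img7"

section \<open>The three maps are locally finite iterative higher derivations\<close>

lemma Const_0 [simp]: "Const 0 = 0" by (simp add: Const_def)
lemma Const_1 [simp]: "Const 1 = 1" by (simp add: Const_def)
lemma Const_add: "Const (a + b) = Const a + Const b" by (simp add: Const_def single_add)
lemma Const_mult: "Const (a * b) = Const a * Const b" by (simp add: Const_def mult_single)

lemma monom_val_superset:
  assumes "finite M" "Poly_Mapping.keys m \<subseteq> M"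
  shows "monom_val f m = (\<Prod>v\<in>M. f v ^ Poly_Mapping.lookup m v)"
  unfolding monom_val_def using assms
  by (intro prod.mono_neutral_left) (auto simp: in_keys_iff)

lemma monom_val_add: "monom_val f (m + n) = monom_val f m * monom_val f n"
proof -
  let ?M = "Poly_Mapping.keys m \<union> Poly_Mapping.keys n"
  have "monom_val f (m + n) = (\<Prod>v\<in>?M. f v ^ Poly_Mapping.lookup (m + n) v)"
    by (rule monom_val_superset) (auto dest: subsetD[OF keys_add])
  also have "\<dots> = monom_val f m * monom_val f n"
    by (simp add: monom_val_superset[of ?M m] monom_val_superset[of ?M n] lookup_add power_add
        prod.distrib)
  finally show ?thesis .
qed

lemma mpoly_sum_single:
  fixes p :: "('v, 'k::comm_ring_1) mpoly"
  shows "p = (\<Sum>m\<in>Poly_Mapping.keys p. Poly_Mapping.single m (Poly_Mapping.lookup p m))"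
proof (rule poly_mapping_eqI)
  fix m
  show "Poly_Mapping.lookup p m = Poly_Mapping.lookup
    (\<Sum>m\<in>Poly_Mapping.keys p. Poly_Mapping.single m (Poly_Mapping.lookup p m)) m"
    by (auto simp: lookup_sum lookup_single when_def in_keys_iff)
qed

lemma single_eq_Const_Var:
  fixes c :: "'k::comm_ring_1" and m :: "'v \<Rightarrow>\<^sub>0 nat"
  shows "Poly_Mapping.single m c = Const c * monom_val Var m"
proof -
  have pw: "Var v ^ n = (Poly_Mapping.single (Poly_Mapping.single v n) 1 :: ('v, 'k) mpoly)" for v n
    by (induction n) (simp_all add: Var_def mult_single flip: single_add)
  have pr: "(\<Prod>v\<in>M. Var v ^ Poly_Mapping.lookup m v) =
      (Poly_Mapping.single (\<Sum>v\<in>M. Poly_Mapping.single v (Poly_Mapping.lookup m v)) 1 :: ('v, 'k) mpoly)"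
    if "finite M" for M
    using that by (induction M rule: finite_induct) (simp_all add: pw mult_single)
  have "(\<Sum>v\<in>Poly_Mapping.keys m. Poly_Mapping.single v (Poly_Mapping.lookup m v)) = m"
    by (rule poly_mapping_eqI) (auto simp: lookup_sum lookup_single when_def in_keys_iff)
  then show ?thesis
    by (simp add: monom_val_def pr Const_def mult_single)
qed

lemma mpoly_induct:
  fixes p :: "('v, 'k::comm_ring_1) mpoly"
  assumes C: "\<And>c. P (Const c)" and V: "\<And>v. P (Var v)"
    and A: "\<And>a b. P a \<Longrightarrow> P b \<Longrightarrow> P (a + b)" and M: "\<And>a b. P a \<Longrightarrow> P b \<Longrightarrow> P (a * b)"
  shows "P p"
proof -
  have 1: "P 1" and 0: "P 0" using C[of 1] C[of 0] by simp_all
  have pw: "P (Var v ^ n)" for v n by (induction n) (auto intro: 1 M V)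
  have "P (\<Prod>v\<in>S. Var v ^ g v)" if "finite S" for S and g :: "'v \<Rightarrow> nat"
    using that by (induction S rule: finite_induct) (auto intro: 1 M pw)
  then have sg: "P (Poly_Mapping.single m c)" for m c
    by (simp add: single_eq_Const_Var monom_val_def M C)
  have "P (\<Sum>m\<in>S. Poly_Mapping.single m (g m))" if "finite S" for S g
    using that by (induction S rule: finite_induct) (auto intro: 0 A sg)
  then show ?thesis by (subst mpoly_sum_single) simp
qed

context
  fixes h :: "'k::comm_ring_1 \<Rightarrow> 'r::comm_ring_1" and f :: "'v \<Rightarrow> 'r"
  assumes h0: "h 0 = 0" and h1: "h 1 = 1" and hadd: "\<And>a b. h (a + b) = h a + h b"
    and hmult: "\<And>a b. h (a * b) = h a * h b"
begin

lemma aeval_superset: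
  assumes "finite M" "Poly_Mapping.keys p \<subseteq> M"
  shows "aeval h f p = (\<Sum>m\<in>M. h (Poly_Mapping.lookup p m) * monom_val f m)"
  unfolding aeval_def using assms
  by (intro sum.mono_neutral_left) (auto simp: in_keys_iff h0)

lemma aeval_add: "aeval h f (p + q) = aeval h f p + aeval h f q"
proof -
  let ?M = "Poly_Mapping.keys p \<union> Poly_Mapping.keys q"
  have "aeval h f (p + q) = (\<Sum>m\<in>?M. h (Poly_Mapping.lookup (p + q) m) * monom_val f m)"
    by (rule aeval_superset) (auto dest: subsetD[OF keys_add])
  also have "\<dots> = aeval h f p + aeval h f q"
    by (simp add: aeval_superset[of ?M p] aeval_superset[of ?M q] lookup_add hadd
        distrib_right sum.distrib)
  finally show ?thesis .
qed

lemma aeval_0: "aeval h f 0 = 0" by (simp add: aeval_def)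

lemma aeval_sum: "aeval h f (sum g S) = (\<Sum>i\<in>S. aeval h f (g i))"
  by (induction S rule: infinite_finite_induct) (simp_all add: aeval_0 aeval_add)

lemma aeval_single: "aeval h f (Poly_Mapping.single m c) = h c * monom_val f m"
  by (simp add: aeval_def h0)

lemma aeval_mult: "aeval h f (p * q) = aeval h f p * aeval h f q"
proof -
  have "p * q = (\<Sum>m\<in>Poly_Mapping.keys p. \<Sum>n\<in>Poly_Mapping.keys q.
      Poly_Mapping.single (m + n) (Poly_Mapping.lookup p m * Poly_Mapping.lookup q n))"
    by (subst (1) mpoly_sum_single[of p], subst (1) mpoly_sum_single[of q])
       (simp add: sum_product mult_single)
  then have "aeval h f (p * q) = (\<Sum>m\<in>Poly_Mapping.keys p. \<Sum>n\<in>Poly_Mapping.keys q.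
      h (Poly_Mapping.lookup p m * Poly_Mapping.lookup q n) * monom_val f (m + n))"
    by (simp only: aeval_sum aeval_single)
  also have "\<dots> = aeval h f p * aeval h f q"
    by (simp add: hmult monom_val_add aeval_def sum_product ac_simps)
  finally show ?thesis .
qed

lemma aeval_Const: "aeval h f (Const c) = h c"
  by (simp add: Const_def aeval_single monom_val_def)

lemma aeval_Var: "aeval h f (Var v) = f v"
  by (simp add: Var_def aeval_single h1 monom_val_def)

end

lemma alg_hom_hom_of_vars: "alg_hom (hom_of_vars f)"
  unfolding alg_hom_def hom_of_vars_def
  by (auto intro!: aeval_add aeval_mult aeval_Const simp: Const_add Const_mult one_pCons)

lemma hom_of_vars_Var [simp]: "hom_of_vars f (Var v) = f v"
  unfolding hom_of_vars_def
  by (intro aeval_Var) (auto simp: Const_add Const_mult one_pCons)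

lemma hom_of_vars_unique:
  assumes "alg_hom \<theta>" "\<And>v. \<theta> (Var v) = f v"
  shows "\<theta> = hom_of_vars f"
proof
  fix b
  show "\<theta> b = hom_of_vars f b"
    using assms alg_hom_hom_of_vars[of f]
    by (induction b rule: mpoly_induct) (simp_all add: alg_hom_def)
qed

lemma map_poly_add_hom:
  assumes "h 0 = 0" "\<And>a b. h (a + b) = h a + h b"
  shows "map_poly h (p + q) = map_poly h p + map_poly h q"
  by (rule poly_eqI) (simp add: coeff_map_poly assms)

lemma map_poly_mult_hom:
  fixes h :: "'a::comm_ring_1 \<Rightarrow> 'b::comm_ring_1"
  assumes "h 0 = 0" "\<And>a b. h (a + b) = h a + h b" "\<And>a b. h (a * b) = h a * h b"
  shows "map_poly h (p * q) = map_poly h p * map_poly h q"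
proof -
  have "h (sum g S) = (\<Sum>i\<in>S. h (g i))" for g and S :: "nat set"
    by (induction S rule: infinite_finite_induct) (simp_all add: assms)
  then show ?thesis
    by (intro poly_eqI) (simp add: coeff_map_poly coeff_mult assms)
qed

text \<open>Substitution of \<open>U + W\<close> for \<open>U\<close>, with \<open>W\<close> the outer and \<open>U\<close> the inner indeterminate.\<close>

definition shift_poly :: "'a::comm_ring_1 poly \<Rightarrow> 'a poly poly" where
  "shift_poly p = pcompose (map_poly (\<lambda>c. [:c:]) p) [:[:0, 1:], 1:]"

lemma shift_poly_add: "shift_poly (p + q) = shift_poly p + shift_poly q"
  by (simp add: shift_poly_def map_poly_add_hom pcompose_add)

lemma shift_poly_mult: "shift_poly (p * q) = shift_poly p * shift_poly q"
  by (simp add: shift_poly_def map_poly_mult_hom pcompose_mult)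

lemma shift_poly_0 [simp]: "shift_poly 0 = 0" by (simp add: shift_poly_def)

lemma shift_poly_pCons [simp]:
  "shift_poly (pCons a p) = [:[:a:]:] + [:[:0, 1:], 1:] * shift_poly p"
  by (cases "a = 0 \<and> p = 0") (auto simp: shift_poly_def map_poly_pCons pcompose_pCons)

lemma coeff_shift_poly:
  "coeff (coeff (shift_poly p) k) j = of_nat ((j + k) choose j) * coeff p (j + k)"
proof (induction p arbitrary: j k)
  case 0
  show ?case by simp
next
  case (pCons a p)
  show ?case
    by (cases j; cases k) (simp_all add: pCons.IH coeff_pCons algebra_simps)
qed

lemma lfihdI:
  fixes \<theta> :: "('v, 'k::comm_ring_1) mpoly \<Rightarrow> ('v, 'k) mpoly poly"
  assumes hom: "alg_hom \<theta>" and id: "\<And>v. coeff (\<theta> (Var v)) 0 = Var v"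
    and it: "\<And>v. map_poly \<theta> (\<theta> (Var v)) = shift_poly (\<theta> (Var v))"
  shows "lfihd \<theta>"
proof -
  have C: "\<theta> (Const c) = [:Const c:]" and A: "\<theta> (a + b) = \<theta> a + \<theta> b"
    and M: "\<theta> (a * b) = \<theta> a * \<theta> b" for a b c
    using hom by (auto simp: alg_hom_def)
  have Z: "\<theta> 0 = 0" using C[of 0] by simp
  have 1: "coeff (\<theta> b) 0 = b" for b
    by (induction b rule: mpoly_induct) (simp_all add: C A M id coeff_mult)
  have 2: "map_poly \<theta> (\<theta> b) = shift_poly (\<theta> b)" for b
  proof (induction b rule: mpoly_induct)
    case (1 c)
    show ?case by (cases "Const c = (0 :: ('v, 'k) mpoly)") (simp_all add: C Z map_poly_pCons)
  qed (simp_all add: it A M map_poly_add_hom map_poly_mult_hom Z shift_poly_add shift_poly_mult)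
  have "coeff (\<theta> (coeff (\<theta> b) k)) j = of_nat ((j + k) choose j) * coeff (\<theta> b) (j + k)" for j k b
  proof -
    have "coeff (\<theta> (coeff (\<theta> b) k)) j = coeff (coeff (map_poly \<theta> (\<theta> b)) k) j"
      by (simp add: coeff_map_poly Z)
    then show ?thesis by (simp only: 2 coeff_shift_poly)
  qed
  then show ?thesis using hom 1 by (simp add: lfihd_def)
qed

lemma map_poly_pCons_hom:
  assumes "h 0 = 0"
  shows "map_poly h (pCons a p) = pCons (h a) (map_poly h p)"
  by (rule poly_eqI) (simp add: coeff_map_poly assms coeff_pCons split: nat.split)

lemma alg_homD:
  assumes "alg_hom \<theta>"
  shows "\<theta> (a + b) = \<theta> a + \<theta> b" "\<theta> (a * b) = \<theta> a * \<theta> b" "\<theta> 0 = 0" "\<theta> 1 = 1"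
    "\<theta> (a ^ n) = \<theta> a ^ n" "\<theta> (numeral w) = numeral w"
proof -
  show a: "\<theta> (a + b) = \<theta> a + \<theta> b" for a b using assms by (simp add: alg_hom_def)
  show m: "\<theta> (a * b) = \<theta> a * \<theta> b" for a b using assms by (simp add: alg_hom_def)
  show "\<theta> 0 = 0" using assms by (metis alg_hom_def Const_0 pCons_0_0)
  show o: "\<theta> 1 = 1" using assms by (metis alg_hom_def Const_1 one_pCons)
  show "\<theta> (a ^ n) = \<theta> a ^ n" by (induction n) (simp_all add: o m)
  show "\<theta> (numeral w) = numeral w" by (induction w) (simp_all only: numeral_One numeral_Bit0 numeral_Bit1 o a)
qed

lemma lfihd_theta5: "lfihd theta5"
proof -
  note h = alg_homD[OF alg_hom_hom_of_vars]
  show ?thesis unfolding theta5_def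
  proof (rule lfihdI[OF alg_hom_hom_of_vars])
    fix v :: vars5
    show "coeff (hom_of_vars img5 (Var v)) 0 = (Var v :: (vars5, 'a) mpoly)" by (cases v) simp_all
    show "map_poly (hom_of_vars img5) (hom_of_vars img5 (Var v)) =
      shift_poly (hom_of_vars img5 (Var v) :: (vars5, 'a) mpoly poly)"
      by (cases v) (simp_all add: h map_poly_pCons_hom numeral_poly poly_const_pow)
  qed
qed

lemma lfihd_theta6: "lfihd theta6"
proof -
  note h = alg_homD[OF alg_hom_hom_of_vars]
  have y: "Var Y6 ^ 6 = (Var Y6 ^ 3 * Var Y6 ^ 3 :: (vars6, 'a) mpoly)"
    by (simp flip: power_add)
  show ?thesis unfolding theta6_def
  proof (rule lfihdI[OF alg_hom_hom_of_vars])
    fix v :: vars6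
    show "coeff (hom_of_vars img6 (Var v)) 0 = (Var v :: (vars6, 'a) mpoly)" by (cases v) simp_all
    show "map_poly (hom_of_vars img6) (hom_of_vars img6 (Var v)) =
      shift_poly (hom_of_vars img6 (Var v) :: (vars6, 'a) mpoly poly)"
      by (cases v; simp add: h map_poly_pCons_hom numeral_poly poly_const_pow)
        (simp only: y mult_ac simp_thms)
  qed
qed

lemma lfihd_theta7: "lfihd theta7"
proof -
  note h = alg_homD[OF alg_hom_hom_of_vars]
  show ?thesis unfolding theta7_def
  proof (rule lfihdI[OF alg_hom_hom_of_vars])
    fix v :: vars7
    show "coeff (hom_of_vars img7 (Var v)) 0 = (Var v :: (vars7, 'a) mpoly)" by (cases v) simp_all
    show "map_poly (hom_of_vars img7) (hom_of_vars img7 (Var v)) =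
      shift_poly (hom_of_vars img7 (Var v) :: (vars7, 'a) mpoly poly)"
      by (cases v) (simp_all add: h map_poly_pCons_hom numeral_poly poly_const_pow)
  qed
qed

end

theory Submission
  imports Defs "HOL-Computational_Algebra.Primes"
begin

text \<open>
  Let \<open>S\<close> be the subring of polynomials not involving \<open>v\<close>.  In characteristic \<open>p > 0\<close> there is an
  invariant \<open>F\<close> that is monic in \<open>v\<close> of degree \<open>p\<close>.  For \<open>p \<noteq> 3\<close> it comes from a cubic in an auxiliary
  indeterminate \<open>T\<close> on which \<open>\<theta>\<close> acts as a translation of \<open>T\<close>: the coefficients just below \<open>T\<^sup>p\<close> of
  a suitable power of this cubic change under the action by a multiple of \<open>U\<^sup>p\<close>, which cancels the
  one in \<open>\<theta>(v)\<^sup>p\<close>, and for \<open>p \<equiv> 1\<close> modulo 3 by a multiple of \<open>U\<close>, which a term linear in \<open>v\<close> absorbs.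

  The leading coefficients with respect to \<open>v\<close> of invariants are invariants in \<open>S\<close>.  If \<open>S\<^sup>\<theta>\<close> is
  finitely generated, hence Noetherian, then the argument of Hilbert's basis theorem, with
  multiplication by \<open>F\<close> in place of multiplication by the variable, shows that \<open>B\<^sup>\<theta>\<close> is a finite
  module over \<open>S\<^sup>\<theta>[F]\<close>.

  The ring \<open>S\<^sup>\<theta>\<close> is generated by explicit invariants: after inverting one variable \<open>x\<close> the
  action becomes a translation in a further variable over them, and the subring they generate is saturated with respect to \<open>x\<close>.  Since the ground field is
  infinite, polynomials and invariance are handled through their values at points.  The invariants
  of \<open>B\<^sub>5\<close> are those of \<open>B\<^sub>6\<close> at \<open>y = 1\<close>.
\<close>

section \<open>Evaluation and substitution\<close>

locale comm_ring_map =
  fixes h :: "'a::comm_ring_1 \<Rightarrow> 'b::comm_ring_1"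
  assumes hom_one [simp]: "h 1 = 1"
    and hom_add [simp]: "h (a + b) = h a + h b"
    and hom_mult [simp]: "h (a * b) = h a * h b"
begin

lemma hom_zero [simp]: "h 0 = 0"
  using hom_add[of 0 0] by simp

lemma hom_minus [simp]: "h (- a) = - h a"
  using hom_add[of a "- a"] by (simp add: eq_neg_iff_add_eq_0 add.commute)

lemma hom_diff [simp]: "h (a - b) = h a - h b"
  using hom_add[of a "- b"] by simp

lemma hom_power [simp]: "h (a ^ n) = h a ^ n"
  by (induction n) simp_all

lemma hom_numeral [simp]: "h (numeral w) = numeral w"
  by (induction w) (simp_all only: numeral_One numeral_Bit0 numeral_Bit1 hom_one hom_add)

lemma hom_sum [simp]: "h (sum g A) = (\<Sum>i\<in>A. h (g i))"
  by (induction A rule: infinite_finite_induct) simp_all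

lemma map_poly_hom [simp]:
  "map_poly h (p + q) = map_poly h p + map_poly h q"
  "map_poly h (p * q) = map_poly h p * map_poly h q"
  "map_poly h (pCons a p) = pCons (h a) (map_poly h p)"
  by (simp_all add: map_poly_add_hom map_poly_mult_hom map_poly_pCons_hom)

lemma map_poly_hom_power [simp]: "map_poly h (p ^ n) = map_poly h p ^ n"
  by (induction n) (simp_all add: map_poly_1)

lemma coeff_map_poly_hom [simp]: "coeff (map_poly h p) n = h (coeff p n)"
  by (simp add: coeff_map_poly)

lemma hom_poly: "h (poly p a) = poly (map_poly h p) (h a)"
  by (induction p) simp_all

end

definition ev :: "('v \<Rightarrow> 'k) \<Rightarrow> ('v, 'k::comm_ring_1) mpoly \<Rightarrow> 'k" where
  "ev pt = aeval (\<lambda>c. c) pt"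

definition subst :: "('v \<Rightarrow> ('w, 'k) mpoly) \<Rightarrow> ('v, 'k::comm_ring_1) mpoly \<Rightarrow> ('w, 'k) mpoly" where
  "subst g = aeval Const g"

lemma ev_Const [simp]: "ev pt (Const c) = c"
  and ev_Var [simp]: "ev pt (Var w) = pt w"
  by (simp_all add: ev_def aeval_Const aeval_Var)

lemma subst_Const [simp]: "subst g (Const c) = Const c"
  and subst_Var [simp]: "subst g (Var w) = g w"
  by (simp_all add: subst_def aeval_Const aeval_Var Const_add Const_mult)

interpretation ev: comm_ring_map "ev pt" for pt
proof
  show "ev pt 1 = 1" using ev_Const[of pt 1] by simp
qed (simp_all add: ev_def aeval_add aeval_mult)

interpretation subst: comm_ring_map "subst g" for g
proof
  show "subst g 1 = 1" using subst_Const[of g 1] by simp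
qed (simp_all add: subst_def aeval_add aeval_mult Const_add Const_mult)

lemmas ev_simps = ev.hom_zero ev.hom_one ev.hom_add ev.hom_mult ev.hom_minus ev.hom_diff
  ev.hom_power ev.hom_numeral ev_Var ev_Const

lemma ev_subst: "ev pt (subst g P) = ev (\<lambda>i. ev pt (g i)) P"
  by (induction P rule: mpoly_induct) simp_all

section \<open>Generated subalgebras\<close>

lemma subalgebraD:
  fixes A :: "('v, 'k::comm_ring_1) mpoly set"
  assumes "subalgebra A"
  shows "Const c \<in> A" "0 \<in> A" "1 \<in> A" "a \<in> A \<Longrightarrow> b \<in> A \<Longrightarrow> a + b \<in> A"
    "a \<in> A \<Longrightarrow> b \<in> A \<Longrightarrow> a * b \<in> A" "a \<in> A \<Longrightarrow> - a \<in> A" "a \<in> A \<Longrightarrow> b \<in> A \<Longrightarrow> a - b \<in> A"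
    "a \<in> A \<Longrightarrow> a ^ n \<in> A" "numeral w \<in> A"
proof -
  show c: "Const c \<in> A" for c using assms by (simp add: subalgebra_def)
  show "0 \<in> A" using c[of 0] by simp
  show o: "1 \<in> A" using c[of 1] by simp
  show a: "a + b \<in> A" if "a \<in> A" "b \<in> A" for a b using assms that by (simp add: subalgebra_def)
  show m: "a * b \<in> A" if "a \<in> A" "b \<in> A" for a b using assms that by (simp add: subalgebra_def)
  have "Const (- 1) = (- 1 :: ('v, 'k) mpoly)"
    using Const_add[of "- 1 :: 'k" 1] by (simp add: eq_neg_iff_add_eq_0)
  then show n: "- a \<in> A" if "a \<in> A" for a using m[OF c[of "- 1"] that] by simp
  show "a - b \<in> A" if "a \<in> A" "b \<in> A" using a[OF that(1) n[OF that(2)]] by simp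
  show "a ^ n \<in> A" if "a \<in> A" by (induction n) (simp_all add: o m that)
  show "numeral w \<in> A"
    by (induction w) (simp_all only: numeral_One numeral_Bit0 numeral_Bit1 o a)
qed

lemma subalgebra_hull: "subalgebra (subalgebra hull G)"
  by (rule hull_in) (auto simp: subalgebra_def)

lemmas hull_closed = subalgebraD[OF subalgebra_hull]

lemma subalgebra_hull_subset: "G \<subseteq> A \<Longrightarrow> subalgebra A \<Longrightarrow> subalgebra hull G \<subseteq> A"
  by (rule hull_minimal)

lemma subalgebra_hull_induct [consumes 1, case_names gen const add mult]:
  assumes "b \<in> subalgebra hull G"
    and "\<And>g. g \<in> G \<Longrightarrow> P g" "\<And>c. P (Const c)"
    and "\<And>a b. a \<in> subalgebra hull G \<Longrightarrow> b \<in> subalgebra hull G \<Longrightarrow> P a \<Longrightarrow> P b \<Longrightarrow> P (a + b)"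
    and "\<And>a b. a \<in> subalgebra hull G \<Longrightarrow> b \<in> subalgebra hull G \<Longrightarrow> P a \<Longrightarrow> P b \<Longrightarrow> P (a * b)"
  shows "P b"
proof -
  have "subalgebra hull G \<subseteq> {b \<in> subalgebra hull G. P b}"
    using assms(2-) by (intro subalgebra_hull_subset)
      (auto intro: hull_inc hull_closed simp: subalgebra_def)
  then show ?thesis using assms(1) by blast
qed

section \<open>Polynomials with coefficients in a subring\<close>

definition polys_over :: "'a::comm_ring_1 set \<Rightarrow> 'a poly set" where
  "polys_over A = {p. \<forall>n. coeff p n \<in> A}"

lemma polys_over_coeff: "p \<in> polys_over A \<Longrightarrow> coeff p n \<in> A"
  by (simp add: polys_over_def)

lemma polys_over_0: "0 \<in> A \<Longrightarrow> 0 \<in> polys_over A"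
  by (simp add: polys_over_def)

lemma polys_over_pCons: "pCons a p \<in> polys_over A \<longleftrightarrow> a \<in> A \<and> p \<in> polys_over A"
  unfolding polys_over_def by (auto simp: coeff_pCons split: nat.splits)

text \<open>Closure under negation is encoded by the single element -1: multiplication by it
  negates, its square is 1, and adding the two gives 0.\<close>

definition unital_subring :: "'a::comm_ring_1 set \<Rightarrow> bool" where
  "unital_subring A \<longleftrightarrow> - 1 \<in> A \<and> (\<forall>a\<in>A. \<forall>b\<in>A. a + b \<in> A) \<and> (\<forall>a\<in>A. \<forall>b\<in>A. a * b \<in> A)"

lemma unital_subringD:
  assumes "unital_subring A"
  shows "0 \<in> A" "1 \<in> A" "a \<in> A \<Longrightarrow> b \<in> A \<Longrightarrow> a + b \<in> A" "a \<in> A \<Longrightarrow> b \<in> A \<Longrightarrow> a * b \<in> A"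
    "a \<in> A \<Longrightarrow> - a \<in> A" "(\<And>i. i \<in> S \<Longrightarrow> g i \<in> A) \<Longrightarrow> sum g S \<in> A"
proof -
  have a: "a + b \<in> A" and m: "a * b \<in> A" if "a \<in> A" "b \<in> A" for a b
    using assms that by (auto simp: unital_subring_def)
  have n: "- 1 \<in> A" using assms by (simp add: unital_subring_def)
  show o: "1 \<in> A" using m[OF n n] by simp
  show z: "0 \<in> A" using a[OF n o] by simp
  show "a \<in> A \<Longrightarrow> b \<in> A \<Longrightarrow> a + b \<in> A" "a \<in> A \<Longrightarrow> b \<in> A \<Longrightarrow> a * b \<in> A" by (fact a m)+
  show "a \<in> A \<Longrightarrow> - a \<in> A" using m[OF n] by simp
  show "(\<And>i. i \<in> S \<Longrightarrow> g i \<in> A) \<Longrightarrow> sum g S \<in> A"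
    by (induction S rule: infinite_finite_induct) (auto intro: z a)
qed

lemma subalgebra_imp_unital_subring: "subalgebra A \<Longrightarrow> unital_subring A"
  using subalgebraD(3-6)[of A] by (auto simp: unital_subring_def)

lemma polys_over_closed:
  assumes "unital_subring A"
  shows "p \<in> polys_over A \<Longrightarrow> q \<in> polys_over A \<Longrightarrow> p + q \<in> polys_over A"
    and "p \<in> polys_over A \<Longrightarrow> q \<in> polys_over A \<Longrightarrow> p * q \<in> polys_over A"
    and "c \<in> A \<Longrightarrow> p \<in> polys_over A \<Longrightarrow> smult c p \<in> polys_over A"
    and "c \<in> A \<Longrightarrow> [:c:] \<in> polys_over A"
    and "p \<in> polys_over A \<Longrightarrow> p ^ n \<in> polys_over A"
proof -
  note A = unital_subringD[OF assms]
  show "p \<in> polys_over A \<Longrightarrow> q \<in> polys_over A \<Longrightarrow> p + q \<in> polys_over A"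
    "c \<in> A \<Longrightarrow> p \<in> polys_over A \<Longrightarrow> smult c p \<in> polys_over A"
    by (auto simp: polys_over_def intro: A)
  show m: "p * q \<in> polys_over A" if "p \<in> polys_over A" "q \<in> polys_over A" for p q
    using that by (auto simp: polys_over_def coeff_mult intro: A)
  show c: "[:c:] \<in> polys_over A" if "c \<in> A" for c
    using that by (auto simp: polys_over_def coeff_pCons intro: A split: nat.splits)
  show "p \<in> polys_over A \<Longrightarrow> p ^ n \<in> polys_over A"
    using c[OF A(2)] by (induction n) (auto intro: m simp: one_pCons)
qed

lemma poly_in_subring:
  assumes "unital_subring A" "p \<in> polys_over A" "a \<in> A"
  shows "poly p a \<in> A"
  using assms(2) by (induction p)
    (auto simp: polys_over_pCons intro!: unital_subringD[OF assms(1)] assms(3))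

text \<open>Values at \<open>g\<close> of polynomials over \<open>subalgebra hull G\<close> are
  closed under the ring operations and include \<open>G\<close> and \<open>g\<close>. This singles
  out one generator, be it a variable, the slice \<open>s\<close> or \<open>v\<close>.\<close>

lemma hull_insert_poly:
  assumes "b \<in> subalgebra hull (insert g G)"
  obtains p where "p \<in> polys_over (subalgebra hull G)" "b = poly p g"
proof -
  note P = polys_over_closed[OF subalgebra_imp_unital_subring[OF subalgebra_hull[of G]]]
  have "\<exists>p\<in>polys_over (subalgebra hull G). b = poly p g"
    using assms
  proof (induction rule: subalgebra_hull_induct)
    case (gen x)
    show ?case
    proof (cases "x = g")
      case True
      then show ?thesis
        by (intro bexI[of _ "[:0, 1:]"]) (auto simp: polys_over_pCons hull_closed polys_over_0)
    next
      case False
      then show ?thesis using gen by (intro bexI[of _ "[:x:]"]) (auto intro!: P hull_inc)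
    qed
  next
    case (const c)
    show ?case by (intro bexI[of _ "[:Const c:]"]) (auto intro!: P hull_closed)
  next
    case (add a b)
    then show ?case by (metis P(1) poly_add)
  next
    case (mult a b)
    then show ?case by (metis P(2) poly_mult)
  qed
  then show ?thesis using that by blast
qed

text \<open>The constant coefficient of a polynomial in \<open>x\<close> is split off. This serves
  as reduction modulo \<open>x\<close> in the saturation arguments.\<close>

lemma hull_insert_decomp:
  assumes "g \<in> subalgebra hull (insert x G)"
  obtains g0 g1 where "g0 \<in> subalgebra hull G" "g1 \<in> subalgebra hull (insert x G)" "g = g0 + x * g1"
proof -
  obtain p where p: "p \<in> polys_over (subalgebra hull G)" "g = poly p x"
    using assms by (rule hull_insert_poly)
  obtain a q where q: "p = pCons a q" by (rule pCons_cases)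
  have "q \<in> polys_over (subalgebra hull (insert x G))"
    using p(1)[unfolded q polys_over_pCons] hull_mono[of G "insert x G" subalgebra] by (auto simp: polys_over_def)
  then have "poly q x \<in> subalgebra hull (insert x G)"
    by (intro poly_in_subring subalgebra_imp_unital_subring subalgebra_hull) (auto intro: hull_inc)
  then show ?thesis using p by (intro that[of a "poly q x"]) (simp_all add: q polys_over_pCons)
qed

lemma hull_empty: "subalgebra hull {} = range Const"
proof
  have "b \<in> range Const" if "b \<in> subalgebra hull {}" for b :: "('a, 'b) mpoly"
    using that by (induction rule: subalgebra_hull_induct)
      (auto simp flip: Const_add Const_mult)
  then show "subalgebra hull {} \<subseteq> (range Const :: ('a, 'b) mpoly set)" by blast
qed (auto intro: hull_closed)

lemma hull_Vars_UNIV: "subalgebra hull (range Var) = UNIV"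
proof -
  have "b \<in> subalgebra hull (range Var)" for b :: "('a, 'b) mpoly"
    by (induction b rule: mpoly_induct) (auto intro: hull_closed hull_inc)
  then show ?thesis by blast
qed

section \<open>Generated subalgebras as images of polynomial rings\<close>

lemma subalgebra_image_subst:
  assumes "subalgebra A"
  shows "subalgebra (subst g ` A)"
  unfolding subalgebra_def
proof (intro conjI allI ballI)
  show "Const c \<in> subst g ` A" for c
    by (rule image_eqI[of _ _ "Const c"]) (simp_all add: subalgebraD[OF assms])
  fix a b assume "a \<in> subst g ` A" "b \<in> subst g ` A"
  then obtain a' b' where "a' \<in> A" "b' \<in> A" "a = subst g a'" "b = subst g b'" by blast
  then show "a + b \<in> subst g ` A" "a * b \<in> subst g ` A"
    using subalgebraD(4,5)[OF assms, of a' b'] by (metis image_eqI subst.hom_add, metis image_eqI subst.hom_mult)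
qed

lemma hull_image_subst: "subalgebra hull (subst g ` G) = subst g ` (subalgebra hull G)"
proof
  show "subalgebra hull (subst g ` G) \<subseteq> subst g ` (subalgebra hull G)"
  proof (rule subalgebra_hull_subset)
    show "subst g ` G \<subseteq> subst g ` (subalgebra hull G)" by (auto intro: hull_inc)
    show "subalgebra (subst g ` (subalgebra hull G))"
      by (intro subalgebra_image_subst subalgebra_hull)
  qed
  have "subst g b \<in> subalgebra hull (subst g ` G)" if "b \<in> subalgebra hull G" for b
    using that by (induction rule: subalgebra_hull_induct) (auto intro: hull_closed hull_inc)
  then show "subst g ` (subalgebra hull G) \<subseteq> subalgebra hull (subst g ` G)" by blast
qed

text \<open>Presents an element as a polynomial expression in the generators; if the generators take
  arbitrary nonzero values on a set of points, \<open>P\<close> can be shown to vanish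
  there.\<close>

lemma hull_image_Var:
  assumes "b \<in> subalgebra hull (range g)"
  obtains P where "b = subst g P"
  using assms hull_image_subst[of g "range Var"] hull_Vars_UNIV
  by (auto simp: image_image)

section \<open>Polynomials as functions\<close>

text \<open>Over a finite field the product of all \<open>X - a\<close>, increased by 1, is a
  nonconstant polynomial without a root.\<close>

lemma infinite_alg_closed: "infinite (UNIV :: 'k::alg_closed_field set)"
proof
  assume fin: "finite (UNIV :: 'k set)"
  let ?p = "(\<Prod>a\<in>UNIV. [:- a, 1:]) + 1 :: 'k poly"
  have "degree (\<Prod>a\<in>(UNIV :: 'k set). [:- a, 1:]) = card (UNIV :: 'k set)"
    by (subst degree_prod_eq_sum_degree) auto
  moreover have "card (UNIV :: 'k set) > 0" using fin by (simp add: card_gt_0_iff)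
  ultimately have "degree ?p > 0" by (subst degree_add_eq_left) auto
  then obtain x where "poly ?p x = 0" using alg_closed_imp_poly_has_root by blast
  moreover have "poly (\<Prod>a\<in>UNIV. [:- a, 1:]) x = 0"
    using fin by (auto simp: poly_prod intro!: prod_zero)
  ultimately show False by simp
qed

text \<open>Nonzero arguments are still infinitely many. Excluding 0 allows work at points where all
  coordinates can be divided by.\<close>

lemma poly_eq_0_infinite:
  fixes p :: "'k::alg_closed_field poly"
  assumes "\<And>c. c \<noteq> 0 \<Longrightarrow> poly p c = 0"
  shows "p = 0"
proof (rule ccontr)
  assume "p \<noteq> 0"
  then have "finite {x. poly p x = 0}" by (rule poly_roots_finite)
  moreover have "UNIV \<subseteq> insert 0 {x. poly p x = 0}" using assms by auto
  ultimately show False using infinite_alg_closed finite_subset by blast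
qed

lemma ev_fun_upd:
  assumes "b \<in> subalgebra hull (Var ` V)" "\<And>w. w \<in> V \<Longrightarrow> pt w = pt' w"
  shows "ev pt b = ev pt' b"
  using assms(1) by (induction rule: subalgebra_hull_induct) (auto simp: assms(2))

text \<open>Induction on the set of variables: for fixed values of the others, the polynomial in the
  new variable \<open>w\<close> has infinitely many roots, so each of its coefficients vanishes at
  all points considered and the induction hypothesis applies.\<close>

lemma mpoly_eq_0I:
  fixes b :: "('v::finite, 'k::alg_closed_field) mpoly"
  assumes "\<And>pt. (\<And>w. pt w \<noteq> 0) \<Longrightarrow> ev pt b = 0"
  shows "b = 0"
proof -
  have "b = 0" if "finite V" "b \<in> subalgebra hull (Var ` V)"
    "\<And>pt. (\<And>w. pt w \<noteq> 0) \<Longrightarrow> ev pt b = 0" for V and b :: "('v, 'k) mpoly"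
    using that
  proof (induction V arbitrary: b rule: finite_induct)
    case empty
    then obtain c where "b = Const c" by (auto simp: hull_empty)
    then show ?case using empty(2)[of "\<lambda>_. 1"] by simp
  next
    case (insert w V)
    from insert.prems(1) obtain p
      where p: "p \<in> polys_over (subalgebra hull (Var ` V))" "b = poly p (Var w)"
      by (auto elim: hull_insert_poly)
    have "coeff p n = 0" for n
    proof (rule insert.IH)
      show c: "coeff p n \<in> subalgebra hull (Var ` V)" for n using p(1) by (rule polys_over_coeff)
      fix pt :: "'v \<Rightarrow> 'k" assume pt: "\<And>w. pt w \<noteq> 0"
      have "map_poly (ev pt) p = 0"
      proof (rule poly_eq_0_infinite)
        fix z :: 'k assume "z \<noteq> 0"
        then have "ev (pt(w := z)) b = 0" using pt by (intro insert.prems) auto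
        moreover have "map_poly (ev (pt(w := z))) p = map_poly (ev pt) p"
          using insert.hyps by (intro poly_eqI) (auto intro!: ev_fun_upd[OF c])
        ultimately show "poly (map_poly (ev pt) p) z = 0" by (simp add: p(2) ev.hom_poly)
      qed
      then show "ev pt (coeff p n) = 0" by (metis ev.coeff_map_poly_hom coeff_0)
    qed
    then have "p = 0" by (intro poly_eqI) simp
    then show ?case using p(2) by simp
  qed
  then show ?thesis using assms hull_Vars_UNIV by (metis UNIV_I finite)
qed

lemma mpoly_eqI_ev:
  fixes a b :: "('v::finite, 'k::alg_closed_field) mpoly"
  assumes "\<And>pt. (\<And>w. pt w \<noteq> 0) \<Longrightarrow> ev pt a = ev pt b"
  shows "a = b"
  using mpoly_eq_0I[of "a - b"] assms by simp

text \<open>At points with nonzero coordinates the factor can be divided out of the values.\<close>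

lemma Var_mult_cancel:
  fixes a b :: "('v::finite, 'k::alg_closed_field) mpoly"
  assumes "Var w * a = Var w * b"
  shows "a = b"
proof (rule mpoly_eqI_ev)
  fix pt :: "'v \<Rightarrow> 'k" assume "\<And>w. pt w \<noteq> 0"
  then show "ev pt a = ev pt b"
    using arg_cong[OF assms, of "ev pt"] by simp
qed

section \<open>Noetherian subrings and leading coefficients\<close>

inductive_set lin_span :: "'a::comm_ring_1 set \<Rightarrow> 'a set \<Rightarrow> 'a set" for R G where
  zero: "0 \<in> lin_span R G"
| step: "x \<in> lin_span R G \<Longrightarrow> r \<in> R \<Longrightarrow> g \<in> G \<Longrightarrow> r * g + x \<in> lin_span R G"

definition ideal_of :: "'a::comm_ring_1 set \<Rightarrow> 'a set \<Rightarrow> bool" where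
  "ideal_of R I \<longleftrightarrow> I \<subseteq> R \<and> 0 \<in> I \<and> (\<forall>a\<in>I. \<forall>b\<in>I. a + b \<in> I) \<and> (\<forall>r\<in>R. \<forall>a\<in>I. r * a \<in> I)"

definition noetherian :: "'a::comm_ring_1 set \<Rightarrow> bool" where
  "noetherian R \<longleftrightarrow> unital_subring R \<and>
     (\<forall>I. ideal_of R I \<longrightarrow> (\<exists>G. finite G \<and> G \<subseteq> I \<and> I \<subseteq> lin_span R G))"

lemma lin_span_subset:
  assumes "G \<subseteq> I" "ideal_of R I"
  shows "lin_span R G \<subseteq> I"
proof
  fix x assume "x \<in> lin_span R G"
  then show "x \<in> I"
    using assms by induction (auto simp: ideal_of_def)
qed

lemma lin_span_add:
  "a \<in> lin_span R G \<Longrightarrow> b \<in> lin_span R G \<Longrightarrow> a + b \<in> lin_span R G"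
  by (induction a rule: lin_span.induct) (auto simp: add.assoc intro: lin_span.step)

lemma lin_span_mult:
  assumes "unital_subring R" "b \<in> lin_span R G" "a \<in> R"
  shows "a * b \<in> lin_span R G"
  using assms(2)
proof (induction b rule: lin_span.induct)
  case (step x r h)
  then show ?case
    using lin_span.step[of "a * x" R G "a * r" h] unital_subringD(4)[OF assms(1,3), of r]
    by (simp add: algebra_simps)
qed (simp add: lin_span.zero)

text \<open>The union of the chain is an ideal, and its finitely many generators already lie in one
  \<open>J K\<close>, which is therefore the whole union.\<close>

lemma ideal_chain_stable:
  assumes "noetherian R" and ideal: "\<And>k. ideal_of R (J k)" and mono: "\<And>k. J k \<subseteq> J (Suc k)"
  shows "\<exists>K. \<forall>k\<ge>K. J (Suc k) = J k"
proof -
  have le: "J k \<subseteq> J l" if "k \<le> l" for k l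
    using that mono by (rule lift_Suc_mono_le[rotated])
  have "ideal_of R (\<Union>k. J k)"
    unfolding ideal_of_def
  proof (intro conjI ballI)
    have "J k \<subseteq> R" "0 \<in> J k" for k using ideal[of k] by (auto simp: ideal_of_def)
    then show "(\<Union>k. J k) \<subseteq> R" "0 \<in> (\<Union>k. J k)" by blast+
    show "r * a \<in> (\<Union>k. J k)" if "r \<in> R" "a \<in> (\<Union>k. J k)" for r a
    proof -
      obtain k where "a \<in> J k" using \<open>a \<in> (\<Union>k. J k)\<close> by blast
      then have "r * a \<in> J k" using \<open>r \<in> R\<close> ideal[of k] by (simp add: ideal_of_def)
      then show ?thesis by blast
    qed
    fix a b assume "a \<in> (\<Union>k. J k)" "b \<in> (\<Union>k. J k)"
    then obtain k l where "a \<in> J k" "b \<in> J l" by blast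
    then have "a \<in> J (max k l)" "b \<in> J (max k l)" using le[of k "max k l"] le[of l "max k l"] by auto
    then show "a + b \<in> (\<Union>k. J k)" using ideal by (auto simp: ideal_of_def)
  qed
  then obtain G where G: "finite G" "G \<subseteq> (\<Union>k. J k)" "(\<Union>k. J k) \<subseteq> lin_span R G"
    using assms(1) by (auto simp: noetherian_def)
  have "\<exists>K. G' \<subseteq> J K" if "finite G'" "G' \<subseteq> (\<Union>k. J k)" for G'
    using that
  proof (induction G' rule: finite_induct)
    case (insert g G')
    then obtain K k where "G' \<subseteq> J K" "g \<in> J k" by auto
    then have "insert g G' \<subseteq> J (max K k)" using le[of K "max K k"] le[of k "max K k"] by auto
    then show ?case by blast
  qed simp
  then obtain K where "G \<subseteq> J K" using G by blast
  then have "lin_span R G \<subseteq> J K" by (intro lin_span_subset ideal)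
  then have "J k = J K" if "k \<ge> K" for k using G(3) le[OF that] by blast
  then show ?thesis by (metis le_Suc_eq)
qed

text \<open>The module generated by \<open>G\<close> over the ring \<open>R[F]\<close>, with
  multiplication by \<open>R\<close> and by \<open>F\<close> as separate closure rules.\<close>

inductive_set poly_span :: "'a::comm_ring_1 set \<Rightarrow> 'a poly \<Rightarrow> 'a poly set \<Rightarrow> 'a poly set" for R F G where
  zero: "0 \<in> poly_span R F G"
| gen: "g \<in> G \<Longrightarrow> g \<in> poly_span R F G"
| add: "p \<in> poly_span R F G \<Longrightarrow> q \<in> poly_span R F G \<Longrightarrow> p + q \<in> poly_span R F G"
| smult: "r \<in> R \<Longrightarrow> p \<in> poly_span R F G \<Longrightarrow> smult r p \<in> poly_span R F G"
| mult: "p \<in> poly_span R F G \<Longrightarrow> F * p \<in> poly_span R F G"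

lemma coeff_monic_mult:
  fixes F p :: "'a::comm_ring_1 poly"
  assumes "lead_coeff F = 1" "degree p \<le> n"
  shows "coeff (F * p) (degree F + n) = coeff p n" "degree (F * p) \<le> degree F + n"
proof -
  have "coeff (F * p) (degree F + n) = (\<Sum>i\<le>degree F + n. if i = degree F then coeff p n else 0)"
    unfolding coeff_mult
  proof (intro sum.cong refl)
    fix i assume "i \<in> {..degree F + n}"
    show "coeff F i * coeff p (degree F + n - i) = (if i = degree F then coeff p n else 0)"
    proof (cases i "degree F" rule: linorder_cases)
      case less
      then have "degree p < degree F + n - i" using assms(2) by simp
      then show ?thesis using less by (simp add: coeff_eq_0)
    qed (use assms(1) in \<open>auto simp: coeff_eq_0\<close>)
  qed
  then show "coeff (F * p) (degree F + n) = coeff p n" by simp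
  show "degree (F * p) \<le> degree F + n"
    using degree_mult_le[of F p] assms(2) by simp
qed

text \<open>
  The argument of Hilbert's basis theorem.  Multiplication by the monic \<open>F\<close> makes the leading
  coefficient ideals increase along residue classes of the degree modulo \<open>degree F\<close>, so they
  become stationary.
\<close>

lemma leading_coeff_generation:
  fixes M :: "'a::comm_ring_1 poly set"
  assumes R: "noetherian R" and F: "lead_coeff F = 1" "degree F > 0"
    and M0: "0 \<in> M" and Madd: "\<And>p q. p \<in> M \<Longrightarrow> q \<in> M \<Longrightarrow> p + q \<in> M"
    and Msm: "\<And>r p. r \<in> R \<Longrightarrow> p \<in> M \<Longrightarrow> smult r p \<in> M"
    and MF: "\<And>p. p \<in> M \<Longrightarrow> F * p \<in> M"
    and lc: "\<And>p. p \<in> M \<Longrightarrow> lead_coeff p \<in> R"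
  obtains G where "finite G" "G \<subseteq> M" "M \<subseteq> poly_span R F G"
proof -
  let ?d = "degree F"
  \<comment> \<open>Taking the coefficient at \<open>n\<close> under the bound
    \<open>degree p \<le> n\<close> admits 0, which makes \<open>L n\<close> closed under addition;
    its nonzero elements are leading coefficients.\<close>
  define P where "P n = {p \<in> M. degree p \<le> n}" for n
  define L where "L n = (\<lambda>p. coeff p n) ` P n" for n
  note sub = unital_subringD[OF R[unfolded noetherian_def, THEN conjunct1]]
  have ideal: "ideal_of R (L n)" for n
    unfolding ideal_of_def
  proof (intro conjI ballI)
    show "L n \<subseteq> R"
    proof
      fix c assume "c \<in> L n"
      then obtain p where p: "p \<in> M" "degree p \<le> n" "c = coeff p n" by (auto simp: L_def P_def)
      then show "c \<in> R" using lc[OF p(1)] sub(1) by (cases "degree p = n") (auto simp: coeff_eq_0)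
    qed
    show "0 \<in> L n" using M0 by (auto simp: L_def P_def intro!: image_eqI[of _ _ 0])
  next
    fix a b assume "a \<in> L n" "b \<in> L n"
    then obtain p q where "p \<in> P n" "q \<in> P n" "a = coeff p n" "b = coeff q n" by (auto simp: L_def)
    then show "a + b \<in> L n" unfolding L_def
      by (intro image_eqI[of _ _ "p + q"]) (auto simp: P_def Madd intro: degree_add_le)
  next
    fix r a assume "r \<in> R" "a \<in> L n"
    then obtain p where "p \<in> P n" "a = coeff p n" by (auto simp: L_def)
    then show "r * a \<in> L n" unfolding L_def using \<open>r \<in> R\<close>
      by (intro image_eqI[of _ _ "smult r p"])
        (auto simp: P_def Msm intro: order.trans[OF degree_smult_le])
  qed
  have shift: "F * p \<in> P (?d + n)" "coeff (F * p) (?d + n) = coeff p n" if "p \<in> P n" for p n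
    using coeff_monic_mult[OF F(1), of p n] that by (auto simp: P_def MF)
  have Lmono: "L n \<subseteq> L (?d + n)" for n
  proof
    fix c assume "c \<in> L n"
    then obtain p where "p \<in> P n" "c = coeff p n" by (auto simp: L_def)
    then show "c \<in> L (?d + n)" unfolding L_def using shift[of p n]
      by (intro image_eqI[of _ _ "F * p"]) auto
  qed
  have "\<exists>K. \<forall>k\<ge>K. L (i + Suc k * ?d) = L (i + k * ?d)" for i
    by (rule ideal_chain_stable[OF R ideal]) (use Lmono[of "i + _ * ?d"] in \<open>simp add: algebra_simps\<close>)
  then obtain K where K: "\<And>i k. k \<ge> K i \<Longrightarrow> L (i + Suc k * ?d) = L (i + k * ?d)" by metis
  \<comment> \<open>A common bound for the residue classes modulo \<open>degree F\<close>: from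
    \<open>N\<close> on, each of them is stationary.\<close>
  define N where "N = (\<Sum>i<?d. K i * ?d)"
  have stable: "L (?d + n) = L n" if "n \<ge> N" for n
  proof -
    let ?i = "n mod ?d"
    have "K ?i * ?d \<le> N" unfolding N_def using F(2) by (intro member_le_sum) auto
    then have "K ?i * ?d \<le> n" using that by simp
    then have "K ?i \<le> n div ?d" using F(2) by (simp add: less_eq_div_iff_mult_less_eq)
    from K[OF this] show ?thesis by (simp add: algebra_simps)
  qed
  have "\<exists>G. finite G \<and> G \<subseteq> P n \<and> L n \<subseteq> lin_span R ((\<lambda>p. coeff p n) ` G)" for n
  proof -
    obtain C where C: "finite C" "C \<subseteq> L n" "L n \<subseteq> lin_span R C"
      using R ideal[of n] by (auto simp: noetherian_def)
    then show ?thesis unfolding L_def using finite_subset_image[OF C(1), of "\<lambda>p. coeff p n" "P n"]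
      by (metis L_def)
  qed
  then obtain gs where gs: "\<And>n. finite (gs n)" "\<And>n. gs n \<subseteq> P n"
    "\<And>n. L n \<subseteq> lin_span R ((\<lambda>p. coeff p n) ` gs n)" by metis
  \<comment> \<open>In degrees \<open>n \<ge> degree F + N\<close> the ideal \<open>L n\<close>
    equals \<open>L (n - degree F)\<close>, so multiples of \<open>F\<close> supply all leading
    coefficients and no new generators are chosen.\<close>
  define G where "G = (\<Union>n<?d + N. gs n)"
  note span = poly_span.intros
  have top: "\<exists>q \<in> P n \<inter> poly_span R F G. coeff q n = c"
    if "c \<in> L n" "\<And>q m. m < n \<Longrightarrow> q \<in> P m \<Longrightarrow> q \<in> poly_span R F G" for c n
  proof (cases "n < ?d + N")
    case True
    have "c \<in> lin_span R ((\<lambda>p. coeff p n) ` gs n)" using gs(3) that(1) by blast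
    then show ?thesis
    proof induction
      case zero
      show ?case by (intro bexI[of _ 0]) (auto simp: P_def M0 span)
    next
      case (step x r g)
      then obtain q h where q: "q \<in> P n \<inter> poly_span R F G" "coeff q n = x"
        and h: "h \<in> gs n" "g = coeff h n" by auto
      have "h \<in> P n \<inter> poly_span R F G" using h gs(2)[of n] True by (auto simp: G_def intro: span)
      then show ?case using q h(2) step(2)
        by (intro bexI[of _ "smult r h + q"])
          (auto simp: P_def intro!: span(3,4) degree_add_le Madd Msm
            intro: order.trans[OF degree_smult_le])
    qed
  next
    case False
    then obtain m where m: "n = ?d + m" "m \<ge> N" by (metis le_add_diff_inverse add_leE not_less nat_add_left_cancel_le)
    then have "c \<in> L m" using stable that(1) by simp
    then obtain q where q: "q \<in> P m" "c = coeff q m" by (auto simp: L_def)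
    moreover have "q \<in> poly_span R F G" using that(2)[of m q] q m F(2) by simp
    ultimately show ?thesis
      unfolding m(1) using shift[of q m] by (intro bexI[of _ "F * q"]) (auto intro: span)
  qed
  have "p \<in> P n \<Longrightarrow> p \<in> poly_span R F G" for p n
  proof (induction n arbitrary: p rule: less_induct)
    case (less n)
    have "coeff p n \<in> L n" using less.prems by (auto simp: L_def)
    then have "\<exists>q \<in> P n \<inter> poly_span R F G. coeff q n = coeff p n"
      by (rule top) (rule less.IH)
    then obtain q
      where q: "q \<in> P n" "q \<in> poly_span R F G" "coeff q n = coeff p n" by auto
    have "p \<in> M" "smult (- 1) q \<in> M" using less.prems q(1) Msm[OF sub(5)[OF sub(2)], of q] by (auto simp: P_def)
    from Madd[OF this] have r: "p - q \<in> M" by simp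
    have "p - q \<in> poly_span R F G"
    proof (cases "p - q = 0")
      case False
      have "degree (p - q) \<le> n" using less.prems q(1) by (auto simp: P_def intro: degree_diff_le)
      moreover have "degree (p - q) \<noteq> n" using False q(3) by (metis coeff_diff leading_coeff_0_iff right_minus_eq)
      ultimately show ?thesis
        using r by (intro less.IH[of "degree (p - q)"]) (auto simp: P_def)
    qed (simp add: span)
    then have "(p - q) + q \<in> poly_span R F G" using q(2) by (rule span)
    then show ?case by simp
  qed
  then have "M \<subseteq> poly_span R F G" by (auto simp: P_def)
  moreover have "finite G" "G \<subseteq> M" using gs(1,2) by (auto simp: G_def P_def)
  ultimately show ?thesis using that by blast
qed

text \<open>Hilbert's basis theorem, as the case of \<open>leading_coeff_generation\<close> where
  \<open>F\<close> is the indeterminate: ideals are pulled back along evaluation at \<open>g\<close>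
  and the generators pushed forward.\<close>

lemma noetherian_adjoin:
  assumes "noetherian R"
  shows "noetherian ((\<lambda>p. poly p g) ` polys_over R)"
proof -
  have R: "unital_subring R" using assms by (simp add: noetherian_def)
  note sub = unital_subringD[OF R] and P = polys_over_closed[OF R]
  let ?E = "\<lambda>p. poly p g" and ?X = "[:0, 1:]"
  let ?S = "?E ` polys_over R"
  have X: "?X \<in> polys_over R" by (auto simp: polys_over_pCons polys_over_0 sub)
  show ?thesis
    unfolding noetherian_def
  proof (intro conjI allI impI)
    show S: "unital_subring ?S"
      unfolding unital_subring_def
    proof (intro conjI ballI)
      show "- 1 \<in> ?S" by (intro image_eqI[of _ _ "[:- 1:]"]) (auto intro: P sub)
      fix a b assume "a \<in> ?S" "b \<in> ?S"
      then obtain p q where "p \<in> polys_over R" "q \<in> polys_over R" "a = ?E p" "b = ?E q" by blast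
      then show "a + b \<in> ?S" "a * b \<in> ?S"
        using P(1,2)[of p q] by (metis image_eqI poly_add, metis image_eqI poly_mult)
    qed
    fix I assume I: "ideal_of ?S I"
    define M where "M = {p \<in> polys_over R. ?E p \<in> I}"
    have Imult: "a * b \<in> I" if "a \<in> ?S" "b \<in> I" for a b using that I by (auto simp: ideal_of_def)
    obtain G where G: "finite G" "G \<subseteq> M" "M \<subseteq> poly_span R ?X G"
    proof (rule leading_coeff_generation[OF assms, of ?X M])
      show "0 \<in> M" using I by (auto simp: M_def ideal_of_def polys_over_0 sub)
      show "p + q \<in> M" if "p \<in> M" "q \<in> M" for p q
        using that I by (auto simp: M_def ideal_of_def P)
      show "smult r p \<in> M" if "r \<in> R" "p \<in> M" for r p
        using that Imult[of r "?E p"] image_eqI[of r ?E "[:r:]"] by (auto simp: M_def P)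
      show "?X * p \<in> M" if "p \<in> M" for p
        using that Imult[of "?E ?X" "?E p"] image_eqI[OF refl X, of ?E] P(2)[OF X, of p] by (auto simp: M_def)
      show "lead_coeff p \<in> R" if "p \<in> M" for p
        using that by (auto simp: M_def polys_over_def)
    qed auto
    have "?E p \<in> lin_span ?S (?E ` G)" if "p \<in> poly_span R ?X G" for p
      using that
    proof induction
      case (gen h)
      then show ?case using lin_span.step[OF lin_span.zero, of 1 ?S "?E h" "?E ` G"] unital_subringD(2)[OF S]
        by simp
    next
      case (smult r p)
      then show ?case using lin_span_mult[OF S, of "?E p" _ r] image_eqI[of r ?E "[:r:]"] by (auto simp: P)
    next
      case (mult p)
      then show ?case using lin_span_mult[OF S, of "?E p" _ g] image_eqI[OF refl X, of ?E] by auto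
    qed (auto intro: lin_span_add lin_span.zero)
    moreover have "I \<subseteq> ?E ` M" using I by (auto simp: M_def ideal_of_def)
    ultimately have "I \<subseteq> lin_span ?S (?E ` G)" using G(3) by blast
    then show "\<exists>G. finite G \<and> G \<subseteq> I \<and> I \<subseteq> lin_span ?S G"
      using G(1,2) by (intro exI[of _ "?E ` G"]) (auto simp: M_def)
  qed
qed

text \<open>Generators are adjoined one at a time, starting from the constants, where any nonzero
  element of an ideal generates it because the constants form a field.\<close>

lemma noetherian_hull:
  fixes G :: "('v, 'k::field) mpoly set"
  assumes "finite G"
  shows "noetherian (subalgebra hull G)"
  using assms
proof (induction G rule: finite_induct)
  case empty
  have "\<exists>G. finite G \<and> G \<subseteq> I \<and> I \<subseteq> lin_span (subalgebra hull {}) G"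
    if I: "ideal_of (subalgebra hull {}) I" for I :: "('v, 'k) mpoly set"
  proof (cases "I = {0}")
    case True
    then show ?thesis by (intro exI[of _ "{}"]) (auto intro: lin_span.zero)
  next
    case False
    then obtain a where a: "a \<in> I" "a \<noteq> 0" using I by (auto simp: ideal_of_def)
    then obtain c where "a = Const c" using I by (auto simp: ideal_of_def hull_empty)
    with a have c: "a = Const c" "c \<noteq> 0" by auto
    have "b \<in> lin_span (subalgebra hull {}) {a}" if "b \<in> I" for b
    proof -
      from I that have "b \<in> range Const" unfolding ideal_of_def hull_empty by blast
      then obtain d where "b = Const d" by blast
      then have "b = Const (d / c) * a + 0" using c by (simp flip: Const_mult)
      then show ?thesis by (metis lin_span.intros hull_closed(1) singletonI)
    qed
    then show ?thesis using a by (intro exI[of _ "{a}"]) auto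
  qed
  then show ?case
    by (simp add: noetherian_def subalgebra_imp_unital_subring subalgebra_hull)
next
  case (insert g G)
  have "(\<lambda>p. poly p g) ` polys_over (subalgebra hull G) = subalgebra hull (insert g G)"
  proof
    show "subalgebra hull (insert g G) \<subseteq> (\<lambda>p. poly p g) ` polys_over (subalgebra hull G)"
      by (blast elim: hull_insert_poly)
    have "polys_over (subalgebra hull G) \<subseteq> polys_over (subalgebra hull (insert g G))"
      using hull_mono[of G "insert g G" subalgebra] by (auto simp: polys_over_def)
    then show "(\<lambda>p. poly p g) ` polys_over (subalgebra hull G) \<subseteq> subalgebra hull (insert g G)"
      using poly_in_subring[OF subalgebra_imp_unital_subring[OF subalgebra_hull], of _ "insert g G" g]
      by (auto simp: hull_inc)
  qed
  then show ?case using noetherian_adjoin[OF insert.IH, of g] by simp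
qed

section \<open>Invariants as functions\<close>

text \<open>The action of the additive group on points: \<open>hom_of_vars f\<close> is its
  comorphism, with \<open>U\<close> specialised to \<open>l\<close>.\<close>

definition act :: "('v \<Rightarrow> ('v, 'k::comm_ring_1) mpoly poly) \<Rightarrow> 'k \<Rightarrow> ('v \<Rightarrow> 'k) \<Rightarrow> 'v \<Rightarrow> 'k" where
  "act f l pt w = poly (map_poly (ev pt) (f w)) l"

lemma ev_act: "ev (act f l pt) b = poly (map_poly (ev pt) (hom_of_vars f b)) l"
proof (induction b rule: mpoly_induct)
  case (1 c)
  show ?case using alg_hom_hom_of_vars[of f] by (simp add: alg_hom_def)
qed (simp_all add: act_def alg_homD[OF alg_hom_hom_of_vars])

lemma ev_act_invariant:
  assumes "lfihd (hom_of_vars f)" "b \<in> invariants (hom_of_vars f)"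
  shows "ev (act f l pt) b = ev pt b"
proof -
  have "coeff (hom_of_vars f b) n = coeff [:b:] n" for n
    using assms by (cases n) (auto simp: invariants_def lfihd_def)
  then have "hom_of_vars f b = [:b:]" by (intro poly_eqI)
  then show ?thesis by (simp add: ev_act)
qed

text \<open>At a fixed point, \<open>hom_of_vars f b\<close> becomes a polynomial in
  \<open>l\<close> that is constant at infinitely many arguments. Its higher coefficients thus
  vanish at all points with nonzero coordinates, hence identically.\<close>

lemma invariantI:
  fixes b :: "('v::finite, 'k::alg_closed_field) mpoly"
  assumes "\<And>l pt. (\<And>w. pt w \<noteq> 0) \<Longrightarrow> ev (act f l pt) b = ev pt b"
  shows "b \<in> invariants (hom_of_vars f)"
proof -
  have "coeff (hom_of_vars f b) n = 0" if "n \<ge> 1" for n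
  proof (rule mpoly_eq_0I)
    fix pt :: "'v \<Rightarrow> 'k" assume pt: "\<And>w. pt w \<noteq> 0"
    have "map_poly (ev pt) (hom_of_vars f b) - [:ev pt b:] = 0"
      by (rule poly_eq_0_infinite) (use assms[OF pt] in \<open>simp add: ev_act\<close>)
    then have "map_poly (ev pt) (hom_of_vars f b) = [:ev pt b:]" by simp
    then have "coeff (map_poly (ev pt) (hom_of_vars f b)) n = coeff [:ev pt b:] n" by simp
    then show "ev pt (coeff (hom_of_vars f b) n) = 0"
      using that by (simp add: coeff_pCons split: nat.splits)
  qed
  then show ?thesis by (simp add: invariants_def)
qed

lemma subalgebra_invariants: "subalgebra (invariants (hom_of_vars f))"
proof -
  let ?h = "hom_of_vars f"
  have 1: "\<forall>n\<ge>1. coeff (?h a * ?h b) n = 0"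
    if "\<forall>n\<ge>1. coeff (?h a) n = 0" "\<forall>n\<ge>1. coeff (?h b) n = 0" for a b
  proof -
    have "?h a = [:coeff (?h a) 0:]" "?h b = [:coeff (?h b) 0:]"
      using that by (auto intro!: poly_eqI simp: coeff_pCons split: nat.splits)
    then obtain c d where "?h a = [:c:]" "?h b = [:d:]" by blast
    then show ?thesis by (simp add: coeff_pCons split: nat.splits)
  qed
  have "?h (Const c) = [:Const c:]" for c using alg_hom_hom_of_vars[of f] by (simp add: alg_hom_def)
  then show ?thesis
    unfolding subalgebra_def invariants_def
    by (auto simp: alg_homD[OF alg_hom_hom_of_vars] 1 coeff_pCons split: nat.splits)
qed

section \<open>Actions on \<open>S[v]\<close> that translate \<open>v\<close>\<close>

lemma coeff_pcompose_linear_top: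
  fixes p :: "'a::idom poly"
  assumes "degree p \<le> n"
  shows "coeff (pcompose p [:c, 1:]) n = coeff p n"
proof (cases "degree p = n")
  case True
  then show ?thesis
    using lead_coeff_comp[of "[:c, 1:]" p] by (simp add: degree_pcompose)
qed (use assms in \<open>simp add: coeff_eq_0 degree_pcompose\<close>)

text \<open>The common shape of the examples in six and seven variables: \<open>S\<close> is stable
  under the action, and \<open>v\<close> moves by \<open>U\<close> times an element of
  \<open>S\<close>.\<close>

locale additive_extension =
  fixes f :: "'v::finite \<Rightarrow> ('v, 'k::alg_closed_field) mpoly poly" and v :: 'v
    and a :: "('v, 'k) mpoly" and S :: "('v, 'k) mpoly set"
  assumes lfihd: "lfihd (hom_of_vars f)"
    and f_v: "f v = [:Var v, a:]"
    and S_def: "S = subalgebra hull (Var ` (- {v}))"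
    and a_S: "a \<in> S"
    and f_S: "\<And>w. w \<noteq> v \<Longrightarrow> f w \<in> polys_over S"
begin

abbreviation "Inv \<equiv> invariants (hom_of_vars f)"

lemma subalgebra_S: "subalgebra S"
  by (simp add: S_def subalgebra_hull)

lemma ev_S: "b \<in> S \<Longrightarrow> (\<And>w. w \<noteq> v \<Longrightarrow> pt w = pt' w) \<Longrightarrow> ev pt b = ev pt' b"
  unfolding S_def by (rule ev_fun_upd) auto

text \<open>With the other coordinates fixed and \<open>v\<close> varying, invariance equates the
  original polynomial with a translate of the one whose coefficients have been moved. Translation
  does not affect the top coefficient.\<close>

lemma lead_coeff_invariant:
  assumes p: "p \<in> polys_over S" "poly p (Var v) \<in> Inv"
  shows "lead_coeff p \<in> Inv"
proof (rule invariantI)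
  fix l :: 'k and pt :: "'v \<Rightarrow> 'k" assume pt: "\<And>w. pt w \<noteq> 0"
  let ?q = "map_poly (ev (act f l pt)) p" and ?r = "map_poly (ev pt) p"
  have "pcompose ?q [:ev pt a * l, 1:] - ?r = 0"
  proof (rule poly_eq_0_infinite)
    fix c :: 'k assume "c \<noteq> 0"
    let ?pt = "pt(v := c)"
    have S: "ev ?pt b = ev pt b" if "b \<in> S" for b using that by (rule ev_S) simp
    have "map_poly (ev ?pt) (f w) = map_poly (ev pt) (f w)" if "w \<noteq> v" for w
      by (intro poly_eqI) (simp add: S polys_over_coeff[OF f_S[OF that]])
    then have "act f l ?pt w = act f l pt w" if "w \<noteq> v" for w using that by (simp add: act_def)
    then have "map_poly (ev (act f l ?pt)) p = ?q"
      by (intro poly_eqI) (auto intro: ev_S polys_over_coeff[OF p(1)])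
    moreover have "map_poly (ev ?pt) p = ?r"
      by (intro poly_eqI) (simp add: S polys_over_coeff[OF p(1)])
    moreover have "act f l ?pt v = c + ev pt a * l"
      by (simp add: act_def f_v S[OF a_S] mult.commute)
    ultimately show "poly (pcompose ?q [:ev pt a * l, 1:] - ?r) c = 0"
      using ev_act_invariant[OF lfihd p(2), of l ?pt]
      by (simp add: ev.hom_poly poly_pcompose add.commute)
  qed
  then have "coeff (pcompose ?q [:ev pt a * l, 1:]) (degree p) = coeff ?r (degree p)" by simp
  \<comment> \<open>Specialisation can lower the degree, so the comparison is made at
    \<open>degree p\<close>.\<close>
  moreover have "degree ?q \<le> degree p" by (rule degree_le) (simp add: coeff_eq_0)
  ultimately show "ev (act f l pt) (lead_coeff p) = ev pt (lead_coeff p)"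
    by (simp add: coeff_pcompose_linear_top)
qed

text \<open>Written as polynomials in \<open>v\<close>, the invariants have leading coefficients in
  the Noetherian ring \<open>Inv \<inter> S\<close>. They therefore form a finite module over the
  ring obtained from it by adjoining \<open>F\<close>; module generators, ring generators and
  \<open>F\<close> together generate the algebra.\<close>

theorem fin_gen_invariants_of_monic:
  assumes G: "finite G" "Inv \<inter> S = subalgebra hull G"
    and F: "F \<in> polys_over S" "lead_coeff F = 1" "degree F > 0" "poly F (Var v) \<in> Inv"
  shows "fin_gen_algebra Inv"
proof -
  let ?R = "subalgebra hull G" and ?E = "\<lambda>p. poly p (Var v)"
  define M where "M = {p \<in> polys_over S. ?E p \<in> Inv}"
  note I = subalgebraD[OF subalgebra_invariants[of f]]
  note P = polys_over_closed[OF subalgebra_imp_unital_subring[OF subalgebra_S]]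
  have R: "?R \<subseteq> Inv" "?R \<subseteq> S" using G(2) by auto
  obtain G' where G': "finite G'" "G' \<subseteq> M" "M \<subseteq> poly_span ?R F G'"
  proof (rule leading_coeff_generation[OF noetherian_hull[OF G(1)] F(2,3), of M])
    show "0 \<in> M" by (auto simp: M_def polys_over_0 subalgebraD[OF subalgebra_S] I)
    show "p + q \<in> M" if "p \<in> M" "q \<in> M" for p q using that by (auto simp: M_def P I)
    show "smult r p \<in> M" if "r \<in> ?R" "p \<in> M" for r p using that R by (auto simp: M_def P I)
    show "F * p \<in> M" if "p \<in> M" for p using that F by (auto simp: M_def P I)
    show "lead_coeff p \<in> ?R" if "p \<in> M" for p
      using that lead_coeff_invariant[of p] polys_over_coeff[of p S] unfolding G(2)[symmetric]
      by (auto simp: M_def)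
  qed
  let ?G = "insert (?E F) (G \<union> ?E ` G')"
  have "subalgebra hull ?G = Inv"
  proof
    show "subalgebra hull ?G \<subseteq> Inv"
      using R(1) hull_subset[of G subalgebra] G'(2) F(4)
      by (intro subalgebra_hull_subset subalgebra_invariants) (auto simp: M_def)
    have hull: "?R \<subseteq> subalgebra hull ?G" by (rule hull_mono) auto
    have span: "?E p \<in> subalgebra hull ?G" if "p \<in> poly_span ?R F G'" for p
      using that by induction (use hull in \<open>auto intro: hull_inc intro!: hull_closed(2,4,5)\<close>)
    show "Inv \<subseteq> subalgebra hull ?G"
    proof
      fix b assume b: "b \<in> Inv"
      have "range Var = insert (Var v) (Var ` (- {v}))" by auto
      then have "b \<in> subalgebra hull (insert (Var v) (Var ` (- {v})))"
        using hull_Vars_UNIV by (metis UNIV_I)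
      then obtain p where p: "p \<in> polys_over S" "b = ?E p"
        unfolding S_def by (rule hull_insert_poly)
      then show "b \<in> subalgebra hull ?G" using b span[of p] G'(3) by (auto simp: M_def)
    qed
  qed
  then show ?thesis
    unfolding fin_gen_algebra_def using G(1) G'(1) by (intro exI[of _ ?G]) auto
qed

text \<open>
  Where \<open>e \<noteq> 0\<close>, the function \<open>s\<close> can be moved to any value along an orbit, so an invariant
  polynomial in \<open>s\<close> with invariant coefficients is constant.
\<close>

lemma invariant_slice_poly:
  assumes s: "\<And>l pt. (\<And>w. pt w \<noteq> 0) \<Longrightarrow> ev (act f l pt) s = ev pt s + l * ev pt e"
    and e: "\<And>pt. (\<And>w. pt w \<noteq> 0) \<Longrightarrow> ev pt e \<noteq> 0"
    and p: "p \<in> polys_over Inv" "poly p s \<in> Inv"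
  shows "poly p s = coeff p 0"
proof (rule mpoly_eqI_ev)
  fix pt :: "'v \<Rightarrow> 'k" assume pt: "\<And>w. pt w \<noteq> 0"
  let ?P = "map_poly (ev pt) p"
  have "?P - [:poly ?P (ev pt s):] = 0"
  proof (rule poly_eq_0_infinite)
    fix c :: 'k
    define l where "l = (c - ev pt s) / ev pt e"
    have "map_poly (ev (act f l pt)) p = ?P"
      by (intro poly_eqI) (simp add: ev_act_invariant[OF lfihd polys_over_coeff[OF p(1)]])
    moreover have "ev pt s + l * ev pt e = c" using e[OF pt] by (simp add: l_def)
    ultimately show "poly (?P - [:poly ?P (ev pt s):]) c = 0"
      using ev_act_invariant[OF lfihd p(2), of l pt] s[OF pt, of l] by (simp add: ev.hom_poly)
  qed
  then have "?P = [:poly ?P (ev pt s):]" by simp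
  then have "coeff ?P 0 = poly ?P (ev pt s)" by (metis coeff_pCons_0)
  then show "ev pt (poly p s) = ev pt (coeff p 0)" by (simp add: ev.hom_poly)
qed

text \<open>By \<open>den\<close>, a power of \<open>Var w\<close> times a given invariant is a
  polynomial in the slice \<open>s\<close> over the algebra of \<open>G\<close>; by
  \<open>invariant_slice_poly\<close> it equals its constant coefficient. Saturation then removes
  the factors \<open>Var w\<close> one by one.\<close>

theorem invariants_Int_S_eq_hull:
  assumes G: "G \<subseteq> Inv" "G \<subseteq> S" "Var w \<in> G"
    and s: "\<And>l pt. (\<And>w. pt w \<noteq> 0) \<Longrightarrow> ev (act f l pt) s = ev pt s + l * ev pt e"
    and e: "\<And>pt. (\<And>w. pt w \<noteq> 0) \<Longrightarrow> ev pt e \<noteq> 0"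
    and den: "\<And>u. u \<noteq> v \<Longrightarrow> \<exists>n. Var w ^ n * Var u \<in> subalgebra hull (insert s G)"
    and sat: "\<And>g. g \<in> subalgebra hull G \<Longrightarrow> (\<And>pt. pt w = 0 \<Longrightarrow> ev pt g = 0) \<Longrightarrow>
      \<exists>h \<in> subalgebra hull G. g = Var w * h"
  shows "Inv \<inter> S = subalgebra hull G"
proof
  let ?R = "subalgebra hull G" and ?A = "subalgebra hull (insert s G)"
  have R: "?R \<subseteq> Inv" "?R \<subseteq> S"
    using subalgebra_hull_subset[OF G(1) subalgebra_invariants]
      subalgebra_hull_subset[OF G(2) subalgebra_S] by auto
  then show "?R \<subseteq> Inv \<inter> S" by blast
  have x: "Var w ^ n \<in> ?A" for n using G(3) by (intro hull_closed hull_inc) auto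
  show "Inv \<inter> S \<subseteq> ?R"
  proof
    fix b assume b: "b \<in> Inv \<inter> S"
    have "\<exists>n. Var w ^ n * b \<in> ?A"
      using b[THEN IntD2] unfolding S_def
    proof (induction rule: subalgebra_hull_induct)
      case (gen g)
      then show ?case using den by auto
    next
      case (const c)
      show ?case by (intro exI[of _ 0]) (simp add: hull_closed)
    next
      case (add a b)
      then obtain m n where mn: "Var w ^ m * a \<in> ?A" "Var w ^ n * b \<in> ?A" by blast
      have "Var w ^ (m + n) * (a + b) = Var w ^ n * (Var w ^ m * a) + Var w ^ m * (Var w ^ n * b)"
        by (simp add: algebra_simps power_add)
      also have "\<dots> \<in> ?A" by (intro hull_closed(4,5) mn x)
      finally show ?case ..
    next
      case (mult a b)
      then obtain m n where mn: "Var w ^ m * a \<in> ?A" "Var w ^ n * b \<in> ?A" by blast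
      have "Var w ^ (m + n) * (a * b) = (Var w ^ m * a) * (Var w ^ n * b)"
        by (simp add: algebra_simps power_add)
      also have "\<dots> \<in> ?A" by (intro hull_closed(5) mn)
      finally show ?case ..
    qed
    then obtain n p where n: "p \<in> polys_over ?R" "Var w ^ n * b = poly p s"
      by (meson hull_insert_poly)
    have "Var w ^ n * b \<in> Inv"
      using b G(1,3) by (intro subalgebraD[OF subalgebra_invariants]) auto
    moreover have "p \<in> polys_over Inv" using n(1) R(1) by (auto simp: polys_over_def)
    ultimately have "Var w ^ n * b = coeff p 0"
      using invariant_slice_poly[OF s e, of p] n(2) by simp
    then have "Var w ^ n * b \<in> ?R" using n(1) by (simp add: polys_over_coeff)
    then show "b \<in> ?R"
    proof (induction n)
      case (Suc n)
      then obtain h where "h \<in> ?R" "Var w * (Var w ^ n * b) = Var w * h"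
        using sat[of "Var w ^ Suc n * b"] by (auto simp: mult.assoc)
      then show ?case using Suc.IH Var_mult_cancel by metis
    qed simp
  qed
qed

end

section \<open>Monic invariants\<close>

text \<open>Once the monomial of degree \<open>n + 1\<close> is removed, the coefficient at
  \<open>n\<close> of the rest is translation invariant; the monomial contributes the linear term of
  the binomial expansion.\<close>

lemma coeff_pcompose_linear_second:
  fixes p :: "'a::idom poly"
  assumes "degree p \<le> Suc n"
  shows "coeff (pcompose p [:c, 1:]) n = coeff p n + of_nat (Suc n) * c * coeff p (Suc n)"
proof -
  have 1: "coeff ([:c, 1:] ^ Suc m) m = of_nat (Suc m) * c" for m
  proof (induction m)
    case (Suc m)
    have "coeff ([:c, 1:] ^ Suc (Suc m)) (Suc m)
      = c * coeff ([:c, 1:] ^ Suc m) (Suc m) + coeff ([:c, 1:] ^ Suc m) m"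
      by (subst power_Suc) simp
    then show ?case unfolding Suc.IH coeff_linear_power by (simp add: algebra_simps)
  qed simp
  define q where "q = p - monom (coeff p (Suc n)) (Suc n)"
  have "degree q \<le> n"
  proof (rule degree_le, intro allI impI)
    fix i assume "n < i"
    then show "coeff q i = 0"
      using assms by (cases "i = Suc n") (auto simp: q_def coeff_eq_0)
  qed
  have p: "p = q + monom (coeff p (Suc n)) (Suc n)" by (simp add: q_def)
  have "pcompose (monom b (Suc n)) [:c, 1:] = smult b ([:c, 1:] ^ Suc n)" for b
    by (simp add: pcompose_altdef map_poly_monom poly_monom)
  then have "coeff (pcompose p [:c, 1:]) n
    = coeff q n + coeff p (Suc n) * (of_nat (Suc n) * c)"
    by (subst (1) p) (simp only: pcompose_add coeff_add coeff_smult 1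
        coeff_pcompose_linear_top[OF \<open>degree q \<le> n\<close>])
  moreover have "coeff q n = coeff p n" by (simp add: q_def)
  ultimately show ?thesis by (simp add: mult_ac)
qed

text \<open>
  In characteristic \<open>p\<close> the shift \<open>T \<mapsto> T + c\<close> turns \<open>T\<^sup>p\<close> into \<open>T\<^sup>p + c\<^sup>p\<close>; splitting a polynomial of
  degree less than \<open>2 p\<close> at \<open>T\<^sup>p\<close> shows how its coefficients just below \<open>T\<^sup>p\<close> change.
\<close>

lemma coeff_pcompose_CHAR:
  fixes g :: "'k::field poly" and c :: 'k
  assumes p: "p = CHAR('k)" "p > 0"
  shows "degree g \<le> 2 * p - 1 \<Longrightarrow>
      coeff (pcompose g [:c, 1:]) (p - 1) = coeff g (p - 1) + c ^ p * coeff g (2 * p - 1)"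
    and "degree g \<le> 2 * p - 2 \<Longrightarrow>
      coeff (pcompose g [:c, 1:]) (p - 2) = coeff g (p - 2) - c * coeff g (p - 1) + c ^ p * coeff g (2 * p - 2)"
proof -
  have prime: "prime p" using p prime_CHAR_semidom by blast
  then have p2: "p \<ge> 2" by (rule prime_ge_2_nat)
  define lo hi where "lo = poly_cutoff p g" and "hi = poly_shift p g"
  have g: "g = lo + monom 1 p * hi"
    by (rule poly_eqI) (simp add: lo_def hi_def coeff_poly_cutoff coeff_poly_shift coeff_monom_mult)
  have lo: "degree lo \<le> p - 1"
    by (rule degree_le) (auto simp: lo_def coeff_poly_cutoff)
  have "[:c, 1:] ^ p = ([:c:] + monom 1 1) ^ p" by (simp add: monom_altdef)
  also have "\<dots> = [:c:] ^ p + monom 1 1 ^ p"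
    using prime p(1) by (intro freshmans_dream) simp_all
  also have "\<dots> = [:c ^ p:] + monom 1 p"
    by (simp add: poly_const_pow monom_power)
  \<comment> \<open>The last summand has no coefficients below \<open>T^p\<close>. In the middle one
    the degree bound on \<open>g\<close> makes the coefficient in question the top one, which
    translation preserves.\<close>
  finally have *: "pcompose g [:c, 1:]
    = pcompose lo [:c, 1:] + (smult (c ^ p) (pcompose hi [:c, 1:]) + monom 1 p * pcompose hi [:c, 1:])"
    by (subst g) (simp add: pcompose_add pcompose_mult pcompose_altdef[of "monom 1 p"] map_poly_monom
        poly_monom algebra_simps del: pcompose_altdef)
  {
    assume "degree g \<le> 2 * p - 1"
    then have "degree hi \<le> p - 1"
      by (intro degree_le) (auto simp: hi_def coeff_poly_shift intro!: coeff_eq_0)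
    then show "coeff (pcompose g [:c, 1:]) (p - 1) = coeff g (p - 1) + c ^ p * coeff g (2 * p - 1)"
      using lo p2 unfolding *
      by (simp add: coeff_pcompose_linear_top coeff_monom_mult)
        (simp add: lo_def hi_def coeff_poly_cutoff coeff_poly_shift mult_2)
  next
    assume "degree g \<le> 2 * p - 2"
    then have "degree hi \<le> p - 2"
      by (intro degree_le) (auto simp: hi_def coeff_poly_shift intro!: coeff_eq_0)
    moreover have "Suc (p - 2) = p - 1" "2 * p - 2 = p - 2 + p" using p2 by auto
    \<comment> \<open>The factor \<open>p - 1\<close> from
      \<open>coeff_pcompose_linear_second\<close> is -1 in the field, whence the sign of the term
      linear in \<open>c\<close>.\<close>
    moreover have "of_nat (p - 1) = (- 1 :: 'k)" using p p2 by (simp add: of_nat_diff)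
    ultimately show "coeff (pcompose g [:c, 1:]) (p - 2)
        = coeff g (p - 2) - c * coeff g (p - 1) + c ^ p * coeff g (2 * p - 2)"
      using lo p2 unfolding *
      by (simp add: coeff_pcompose_linear_top coeff_pcompose_linear_second coeff_monom_mult)
        (simp add: lo_def hi_def coeff_poly_cutoff coeff_poly_shift)
  }
qed

text \<open>A product in the expansion with fewer than \<open>e\<close> factors \<open>c r\<close>
  has at least \<open>d - e + 1\<close> factors \<open>a T^3\<close>, so its exponents are at least
  \<open>3 (d - e + 1) > i\<close>. With \<open>y ^ 3\<close> for \<open>c\<close> this allows
  division by powers of \<open>y\<close>.\<close>

lemma coeff_power_monom_add_smult:
  assumes A: "unital_subring A" and "a \<in> A" "c \<in> A" "r \<in> polys_over A"
    and "i + 3 * e < 3 * d + 3"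
  shows "\<exists>h\<in>A. coeff ((monom a 3 + smult c r) ^ d) i = c ^ e * h"
  using assms(5)
proof (induction d arbitrary: i e)
  case 0
  have "coeff (1 :: 'a poly) i \<in> A" using unital_subringD[OF A] by (simp add: coeff_1)
  then show ?case using 0 by (cases e) auto
next
  case (Suc d)
  note sub = unital_subringD[OF A]
  let ?f = "monom a 3 + smult c r"
  have 1: "\<exists>h\<in>A. (if i < 3 then 0 else a * coeff (?f ^ d) (i - 3)) = c ^ e * h"
  proof (cases "i < 3")
    case False
    then have "i - 3 + 3 * e < 3 * d + 3" using Suc.prems by simp
    from Suc.IH[OF this] obtain h where "h \<in> A" "coeff (?f ^ d) (i - 3) = c ^ e * h" by blast
    then show ?thesis using False \<open>a \<in> A\<close> by (intro bexI[of _ "a * h"]) (auto intro: sub)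
  qed (auto intro: sub bexI[of _ 0])
  have 2: "\<exists>h\<in>A. c * coeff (r * ?f ^ d) i = c ^ e * h"
  proof (cases e)
    case 0
    have "coeff (?f ^ d) j \<in> A" for j
      using \<open>a \<in> A\<close> \<open>c \<in> A\<close> \<open>r \<in> polys_over A\<close> sub
      by (intro polys_over_coeff polys_over_closed[OF A]) (auto simp: polys_over_def)
    then have "coeff (r * ?f ^ d) i \<in> A"
      unfolding coeff_mult by (intro sub polys_over_coeff[OF assms(4)])
    then show ?thesis using 0 \<open>c \<in> A\<close> sub(4) by auto
  next
    case e: (Suc e')
    have "\<exists>h\<in>A. coeff (?f ^ d) (i - j) = c ^ e' * h" for j
      using Suc.prems e by (intro Suc.IH) auto
    then obtain h where h: "\<And>j. h j \<in> A" "\<And>j. coeff (?f ^ d) (i - j) = c ^ e' * h j" by metis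
    have "coeff (r * ?f ^ d) i = c ^ e' * (\<Sum>j\<le>i. coeff r j * h j)"
      unfolding coeff_mult h(2) by (simp add: sum_distrib_left mult_ac)
    moreover have "(\<Sum>j\<le>i. coeff r j * h j) \<in> A"
      by (intro sub h polys_over_coeff[OF assms(4)])
    ultimately show ?thesis
      using e by (intro bexI[of _ "\<Sum>j\<le>i. coeff r j * h j"]) (simp_all add: mult.assoc)
  qed
  from 1 2 obtain h1 h2 where "h1 \<in> A" "h2 \<in> A"
    "(if i < 3 then 0 else a * coeff (?f ^ d) (i - 3)) = c ^ e * h1"
    "c * coeff (r * ?f ^ d) i = c ^ e * h2" by blast
  then show ?case
    by (intro bexI[of _ "h1 + h2"])
      (auto simp: distrib_right coeff_monom_mult distrib_left intro: sub)
qed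

context additive_extension
begin

text \<open>
  The hypothesis on \<open>c\<close> says that the action translates the indeterminate of this cubic.  For
  \<open>p \<equiv> 1\<close> modulo 3, with \<open>c\<^sup>(\<^sup>2\<^sup>p\<^sup>-\<^sup>2\<^sup>)\<^sup>/\<^sup>3 = \<Sum> g\<^sub>i T\<^sup>i\<close> and up to powers of \<open>y\<close>, the invariant is
  \<open>v\<^sup>p - g\<^sub>p\<^sub>-\<^sub>1 v + e\<^sup>2 g\<^sub>p\<^sub>-\<^sub>2\<close>.
\<close>

lemma monic_invariant:
  assumes char: "CHAR('k) > 0" "CHAR('k) \<noteq> 3"
    and a: "a = e\<^sup>2 * y\<^sup>2" and ey: "e \<in> S" "y \<in> S" "e \<in> Inv" "y \<in> Inv"
    and nz: "\<And>pt. (\<And>w. pt w \<noteq> 0) \<Longrightarrow> ev pt e \<noteq> 0" "\<And>pt. (\<And>w. pt w \<noteq> 0) \<Longrightarrow> ev pt y \<noteq> 0"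
    and r: "r \<in> polys_over S" "degree r \<le> 2"
    and c: "c = monom (e ^ 3) 3 + smult (y ^ 3) r"
    and shift: "\<And>l pt. map_poly (ev (act f l pt)) c = pcompose (map_poly (ev pt) c) [:- (l * ev pt y ^ 3), 1:]"
  obtains F where "F \<in> polys_over S" "lead_coeff F = 1" "degree F > 0" "poly F (Var v) \<in> Inv"
proof -
  define p where "p = CHAR('k)"
  have prime: "prime p" using char(1) unfolding p_def by (rule prime_CHAR_semidom)
  then have p2: "p \<ge> 2" by (rule prime_ge_2_nat)
  have p0: "p > 0" using p2 by simp
  have neg: "(- z) ^ p = - (z ^ p)" for z :: 'k
    using prime by (intro minus_power_prime_CHAR) (simp_all add: p_def)
  have fd: "(z + w) ^ p = z ^ p + w ^ p" for z w :: 'k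
    using prime by (intro freshmans_dream) (simp_all add: p_def)
  note S = subalgebra_imp_unital_subring[OF subalgebra_S]
  note sub = subalgebraD[OF subalgebra_S]
  note dvd = coeff_power_monom_add_smult[OF S sub(8)[OF ey(1), of 3] sub(8)[OF ey(2), of 3] r(1), folded c]
  have deg: "degree (map_poly (ev pt) c ^ d) = 3 * d" "coeff (map_poly (ev pt) c ^ d) (3 * d) = ev pt e ^ (3 * d)"
    if "\<And>w. pt w \<noteq> 0" for pt d
  proof -
    let ?c = "map_poly (ev pt) c"
    have "degree c \<le> 3"
      unfolding c using r(2) by (intro degree_add_le degree_monom_le order.trans[OF degree_smult_le]) simp
    then have "degree ?c \<le> 3" by (intro degree_le) (simp add: coeff_eq_0)
    moreover have 3: "coeff ?c 3 = ev pt e ^ 3" using r(2) by (simp add: c coeff_eq_0)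
    moreover have "ev pt e \<noteq> 0" using nz that by blast
    ultimately have "degree ?c = 3" "?c \<noteq> 0"
      by (metis le_degree antisym power_not_zero, metis coeff_0 power_not_zero)
    then show "degree (?c ^ d) = 3 * d" by (simp add: degree_power_eq)
    then show "coeff (?c ^ d) (3 * d) = ev pt e ^ (3 * d)"
      using lead_coeff_power[of ?c d] 3 \<open>degree ?c = 3\<close> by (simp add: power_mult)
  qed
  have actv: "act f l pt v = pt v + l * (ev pt e ^ 2 * ev pt y ^ 2)" for l pt
    by (simp add: act_def f_v a)
  have pow: "pcompose q z ^ d = pcompose (q ^ d) z" for q z :: "'k poly" and d
    by (induction d) (simp_all add: pcompose_1 pcompose_mult)
  have co: "ev (act f l pt) (coeff (c ^ d) i)
      = coeff (pcompose (map_poly (ev pt) c ^ d) [:- (l * ev pt y ^ 3), 1:]) i" for l pt d i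
    using arg_cong[OF shift[of l pt], of "\<lambda>q. coeff (q ^ d) i"]
    unfolding pow ev.map_poly_hom_power[symmetric] ev.coeff_map_poly_hom .
  have eyact: "ev (act f l pt) e = ev pt e" "ev (act f l pt) y = ev pt y" for l pt
    using ey by (auto intro: ev_act_invariant[OF lfihd])
  have "\<not> 3 dvd p" using prime char(2) by (auto simp: p_def prime_nat_iff)
  then have "(\<exists>m. p = 3 * m + 1) \<or> (\<exists>m. p = 3 * m + 2)" by presburger
  then consider m where "p = 3 * m + 1" | m where "p = 3 * m + 2" by blast
  then show ?thesis
  proof cases
    case m: 1
    let ?d = "2 * m"
    obtain g where g: "g \<in> S" "coeff (c ^ ?d) (p - 2) = (y ^ 3) ^ (m + 1) * g"
      using dvd[of "p - 2" "m + 1" ?d] m p2 by auto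
    obtain h where h: "h \<in> S" "coeff (c ^ ?d) (p - 1) = (y ^ 3) ^ m * h"
      using dvd[of "p - 1" "m" ?d] m by auto
    let ?F = "monom 1 p + [:e\<^sup>2 * y\<^sup>2 * g, - h:]"
    have "p > 2" using m p2 by (cases "p = 2") auto
    then have d: "degree [:e\<^sup>2 * y\<^sup>2 * g, - h:] < degree (monom 1 p :: ('v, 'k) mpoly poly)"
      by (simp add: degree_monom_eq)
    show ?thesis
    proof (rule that[of ?F])
      show "?F \<in> polys_over S"
        by (intro polys_over_closed[OF S])
          (auto simp: polys_over_def polys_over_pCons coeff_pCons ey g h intro!: sub split: nat.splits)
      show "lead_coeff ?F = 1" "degree ?F > 0"
        using d p2 by (simp_all add: degree_add_eq_left lead_coeff_add_le degree_monom_eq coeff_eq_0)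
      show "poly ?F (Var v) \<in> Inv"
      proof (rule invariantI)
        fix l :: 'k and pt :: "'v \<Rightarrow> 'k" assume pt: "\<And>w. pt w \<noteq> 0"
        let ?e = "ev pt e" and ?y = "ev pt y" and ?g = "ev pt g" and ?h = "ev pt h"
        have y: "?y \<noteq> 0" using nz(2) pt by blast
        let ?P = "map_poly (ev pt) c ^ ?d"
        have deg': "degree ?P = 2 * p - 2" "coeff ?P (2 * p - 2) = ?e ^ (2 * p - 2)"
          using deg[of pt ?d, OF pt] m by simp_all
        then have deg'': "degree ?P \<le> 2 * p - 1" "coeff ?P (2 * p - 1) = 0"
          using p2 by (auto intro: coeff_eq_0)
        have gh: "coeff ?P (p - 2) = (?y ^ 3) ^ (m + 1) * ?g" "coeff ?P (p - 1) = (?y ^ 3) ^ m * ?h"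
          using arg_cong[OF g(2), of "ev pt"] arg_cong[OF h(2), of "ev pt"]
          unfolding ev.map_poly_hom_power[symmetric] ev.coeff_map_poly_hom by simp_all
        \<comment> \<open>Since \<open>3 (m + 1) + (2 p - 2) = 3 p\<close>, dividing by the power of
          \<open>y\<close> split off from \<open>g\<close> leaves \<open>y^(2p-2)\<close>, which the
          factor \<open>y^2\<close> in \<open>?F\<close> completes to \<open>y^(2p)\<close>.\<close>
        have yp: "(?y ^ 3) ^ (m + 1) * ?y ^ (2 * p - 2) = (?y ^ 3) ^ p"
          unfolding power_mult[symmetric] power_add[symmetric] by (simp add: m add.commute)
        have 1: "(?y ^ 3) ^ (m + 1) * ev (act f l pt) g = (?y ^ 3) ^ (m + 1) * ?g
            + l * ?y ^ 3 * ((?y ^ 3) ^ m * ?h) - (l * ?y ^ 3) ^ p * ?e ^ (2 * p - 2)"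
          using co[of l pt ?d "p - 2"]
          unfolding coeff_pcompose_CHAR(2)[OF p_def p0 deg'(1)[THEN eq_refl]] g(2) gh deg'(2) by (simp add: eyact neg)
        have 2: "(?y ^ 3) ^ m * ev (act f l pt) h = (?y ^ 3) ^ m * ?h"
          using co[of l pt ?d "p - 1"]
          unfolding coeff_pcompose_CHAR(1)[OF p_def p0 deg''(1)] h(2) gh deg''(2) by (simp add: eyact)
        then have h': "ev (act f l pt) h = ?h" using y by simp
        have "(?y ^ 3) ^ (m + 1) * ev (act f l pt) g = (?y ^ 3) ^ (m + 1) * (?g + l * ?h
            - l ^ p * ?y ^ (2 * p - 2) * ?e ^ (2 * p - 2))"
          unfolding 1 power_mult_distrib yp[symmetric] by (simp add: algebra_simps)
        then have g': "ev (act f l pt) g = ?g + l * ?h - l ^ p * ?y ^ (2 * p - 2) * ?e ^ (2 * p - 2)"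
          using y by simp
        have "z ^ (2 * p) = z\<^sup>2 * z ^ (2 * p - 2)" for z :: 'k
        proof -
          have "2 * p = 2 + (2 * p - 2)" using p2 by arith
          then show ?thesis by (metis power_add)
        qed
        then have "(?e\<^sup>2 * ?y\<^sup>2) ^ p = ?e\<^sup>2 * ?y\<^sup>2 * (?y ^ (2 * p - 2) * ?e ^ (2 * p - 2))"
          unfolding power_mult_distrib power_mult[symmetric] by (simp only: mult_ac)
        then have "(pt v + l * (?e\<^sup>2 * ?y\<^sup>2)) ^ p
            = pt v ^ p + l ^ p * (?e\<^sup>2 * ?y\<^sup>2 * (?y ^ (2 * p - 2) * ?e ^ (2 * p - 2)))"
          unfolding fd power_mult_distrib[of l] by simp
        then show "ev (act f l pt) (poly ?F (Var v)) = ev pt (poly ?F (Var v))"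
          by (simp add: poly_monom actv eyact g' h') (simp add: algebra_simps)
      qed
    qed
  next
    case m: 2
    \<comment> \<open>Now \<open>3 (2 m + 1) = 2 p - 1\<close>, so the coefficient at
      \<open>p - 1\<close> changes by a multiple of \<open>U^p\<close> alone, and no term linear in
      \<open>v\<close> has to be added.\<close>
    let ?d = "2 * m + 1"
    obtain g where g: "g \<in> S" "coeff (c ^ ?d) (p - 1) = (y ^ 3) ^ (m + 1) * g"
      using dvd[of "p - 1" "m + 1" ?d] m by auto
    let ?F = "monom 1 p + [:e * y * g:]"
    have d: "degree [:e * y * g:] < degree (monom 1 p :: ('v, 'k) mpoly poly)"
      using p2 by (simp add: degree_monom_eq)
    show ?thesis
    proof (rule that[of ?F])
      show "?F \<in> polys_over S"
        by (intro polys_over_closed[OF S])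
          (auto simp: polys_over_def polys_over_pCons coeff_pCons ey g intro!: sub split: nat.splits)
      show "lead_coeff ?F = 1" "degree ?F > 0"
        using d p2 by (simp_all add: degree_add_eq_left lead_coeff_add_le degree_monom_eq coeff_eq_0)
      show "poly ?F (Var v) \<in> Inv"
      proof (rule invariantI)
        fix l :: 'k and pt :: "'v \<Rightarrow> 'k" assume pt: "\<And>w. pt w \<noteq> 0"
        let ?e = "ev pt e" and ?y = "ev pt y" and ?g = "ev pt g"
        have y: "?y \<noteq> 0" using nz(2) pt by blast
        let ?P = "map_poly (ev pt) c ^ ?d"
        have "3 * ?d = 2 * p - 1" using m by simp
        then have deg': "degree ?P = 2 * p - 1" "coeff ?P (2 * p - 1) = ?e ^ (2 * p - 1)"
          using deg[of pt ?d, OF pt] by (simp_all only:)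
        have gh: "coeff ?P (p - 1) = (?y ^ 3) ^ (m + 1) * ?g"
          using arg_cong[OF g(2), of "ev pt"]
          unfolding ev.map_poly_hom_power[symmetric] ev.coeff_map_poly_hom by simp
        have yp: "(?y ^ 3) ^ (m + 1) * ?y ^ (2 * p - 1) = (?y ^ 3) ^ p"
          unfolding power_mult[symmetric] power_add[symmetric] by (simp add: m add.commute)
        have 1: "(?y ^ 3) ^ (m + 1) * ev (act f l pt) g
            = (?y ^ 3) ^ (m + 1) * ?g - (l * ?y ^ 3) ^ p * ?e ^ (2 * p - 1)"
          using co[of l pt ?d "p - 1"]
          unfolding coeff_pcompose_CHAR(1)[OF p_def p0 deg'(1)[THEN eq_refl]] g(2) gh deg'(2) by (simp add: eyact neg)
        have "(?y ^ 3) ^ (m + 1) * ev (act f l pt) g = (?y ^ 3) ^ (m + 1) * (?g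
            - l ^ p * ?y ^ (2 * p - 1) * ?e ^ (2 * p - 1))"
          unfolding 1 power_mult_distrib yp[symmetric] by (simp add: algebra_simps)
        then have g': "ev (act f l pt) g = ?g - l ^ p * ?y ^ (2 * p - 1) * ?e ^ (2 * p - 1)"
          using y by simp
        have "z ^ (2 * p) = z * z ^ (2 * p - 1)" for z :: 'k using p2 by (simp flip: power_Suc)
        then have "(?e\<^sup>2 * ?y\<^sup>2) ^ p = ?e * ?y * (?y ^ (2 * p - 1) * ?e ^ (2 * p - 1))"
          by (simp add: power_mult_distrib mult_ac flip: power_mult)
        then show "ev (act f l pt) (poly ?F (Var v)) = ev pt (poly ?F (Var v))"
          by (simp add: poly_monom actv eyact fd g' power_mult_distrib algebra_simps)
      qed
    qed
  qed
qed

end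

section \<open>Freudenburg's example\<close>

instance vars6 :: finite
proof
  have "(UNIV :: vars6 set) = {X6, Y6, S6, T6, U6, V6}" by (auto intro: vars6.exhaust)
  then show "finite (UNIV :: vars6 set)" by (metis finite.simps)
qed

instance index3 :: finite
proof
  have "(UNIV :: index3 set) = {I1, I2, I3}" by (auto intro: index3.exhaust)
  then show "finite (UNIV :: index3 set)" by (metis finite.simps)
qed

lemma additive_extension_img6:
  "additive_extension (img6 :: vars6 \<Rightarrow> (vars6, 'k::alg_closed_field) mpoly poly) V6
    (Var X6 ^ 2 * Var Y6 ^ 2) (subalgebra hull (Var ` (- {V6})))"
proof
  show "lfihd (hom_of_vars (img6 :: vars6 \<Rightarrow> (vars6, 'k) mpoly poly))"
    using lfihd_theta6 by (simp add: theta6_def)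
  show "img6 w \<in> polys_over (subalgebra hull (Var ` (- {V6})))" if "w \<noteq> V6" for w
    using that by (cases w) (auto simp: polys_over_pCons intro!: hull_closed polys_over_0 intro: hull_inc)
qed (auto intro!: hull_closed intro: hull_inc)

lemma act_img6 [simp]:
  "act img6 l pt X6 = pt X6" "act img6 l pt Y6 = pt Y6"
  "act img6 l pt S6 = pt S6 + l * pt X6 ^ 3"
  "act img6 l pt T6 = pt T6 + l * (2 * pt Y6 ^ 3 * pt S6 + l * (pt X6 ^ 3 * pt Y6 ^ 3))"
  "act img6 l pt U6 = pt U6 + l * (3 * pt Y6 ^ 3 * pt T6 + l * (3 * pt Y6 ^ 6 * pt S6 + l * (pt X6 ^ 3 * pt Y6 ^ 6)))"
  "act img6 l pt V6 = pt V6 + l * (pt X6 ^ 2 * pt Y6 ^ 2)"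
  by (simp_all add: act_def)

text \<open>At \<open>y = 1\<close>, \<open>h6\<close>, \<open>c6\<close> and \<open>d6\<close> are
  the classical seminvariants of the binary cubic with coefficients \<open>x^3, s, t, u\<close>
  (binomial factors split off): up to numerical factors, the leading coefficients of the Hessian and
  of the cubic covariant, and the discriminant.\<close>

definition h6 :: "(vars6, 'k::comm_ring_1) mpoly" where
  "h6 = Var Y6 ^ 3 * Var S6 ^ 2 - Var X6 ^ 3 * Var T6"

definition c6 :: "(vars6, 'k::comm_ring_1) mpoly" where
  "c6 = Var X6 ^ 6 * Var U6 - 3 * Var X6 ^ 3 * Var Y6 ^ 3 * Var S6 * Var T6 + 2 * Var Y6 ^ 6 * Var S6 ^ 3"

definition d6 :: "(vars6, 'k::comm_ring_1) mpoly" where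
  "d6 = Var X6 ^ 6 * Var U6 ^ 2 - 6 * Var X6 ^ 3 * Var Y6 ^ 3 * Var S6 * Var T6 * Var U6
    + 4 * Var X6 ^ 3 * Var Y6 ^ 3 * Var T6 ^ 3 + 4 * Var Y6 ^ 6 * Var S6 ^ 3 * Var U6
    - 3 * Var Y6 ^ 6 * Var S6 ^ 2 * Var T6 ^ 2"

text \<open>In characteristic 2 one has \<open>d6 = e6^2\<close> and \<open>c6 = x^3 e6\<close>, so
  that \<open>e6\<close> replaces both.\<close>

definition e6 :: "(vars6, 'k::comm_ring_1) mpoly" where
  "e6 = Var X6 ^ 3 * Var U6 + Var Y6 ^ 3 * Var S6 * Var T6"

text \<open>The classical syzygy of the binary cubic. It makes \<open>c6\<close> quadratic over the
  other generators.\<close>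

lemma c6_square:
  "c6 * c6 = (4 * Var Y6 ^ 3 * h6 ^ 3 + Var X6 ^ 6 * d6 :: (vars6, 'k::alg_closed_field) mpoly)"
  unfolding c6_def h6_def d6_def by (simp add: algebra_simps eval_nat_numeral)

lemma invariants6_gens:
  "{Var X6, Var Y6, h6, c6, d6 :: (vars6, 'k::alg_closed_field) mpoly} \<subseteq> invariants (hom_of_vars img6)"
proof -
  have "Var X6 \<in> invariants (hom_of_vars (img6 :: _ \<Rightarrow> (vars6, 'k) mpoly poly))"
    "Var Y6 \<in> invariants (hom_of_vars (img6 :: _ \<Rightarrow> (vars6, 'k) mpoly poly))"
    by (auto intro: invariantI)
  moreover have "(h6 :: (vars6, 'k) mpoly) \<in> invariants (hom_of_vars img6)"
    by (rule invariantI) (simp only: h6_def ev_simps act_img6, simp add: algebra_simps eval_nat_numeral)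
  moreover have "(c6 :: (vars6, 'k) mpoly) \<in> invariants (hom_of_vars img6)"
    by (rule invariantI) (simp only: c6_def ev_simps act_img6, simp add: algebra_simps eval_nat_numeral)
  moreover have "(d6 :: (vars6, 'k) mpoly) \<in> invariants (hom_of_vars img6)"
    by (rule invariantI) (simp only: d6_def ev_simps act_img6, simp add: algebra_simps eval_nat_numeral)
  ultimately show ?thesis by simp
qed

text \<open>Over any field the action changes the values of \<open>e6\<close> by twice a polynomial
  expression.\<close>

lemma invariants6_gen_char2:
  assumes "CHAR('k::alg_closed_field) = 2"
  shows "(e6 :: (vars6, 'k) mpoly) \<in> invariants (hom_of_vars img6)"
proof (rule invariantI)
  fix l :: 'k and pt
  have two: "2 = (0 :: 'k)" using assms of_nat_CHAR[where 'a = 'k] by simp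
  have "ev (act img6 l pt) e6 = ev pt e6 + 2 * (l * (2 * pt X6 ^ 3 * pt Y6 ^ 3 * pt T6
      + pt Y6 ^ 6 * pt S6 ^ 2) + 3 * l ^ 2 * pt X6 ^ 3 * pt Y6 ^ 6 * pt S6 + l ^ 3 * pt X6 ^ 6 * pt Y6 ^ 6)"
    unfolding e6_def ev.hom_add ev.hom_mult ev.hom_power ev_Var act_img6 by algebra
  then show "ev (act img6 l pt) e6 = ev pt e6" by (simp add: two)
qed

text \<open>The slice is \<open>s\<close>. For saturation, \<open>y\<close>, \<open>h6\<close> and
  \<open>e6\<close> take arbitrary nonzero values on \<open>x = 0\<close>, so a polynomial in them
  that vanishes there is 0.\<close>

lemma invariants6_S_char2:
  assumes "CHAR('k::alg_closed_field) = 2"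
  shows "invariants (hom_of_vars img6) \<inter> subalgebra hull (Var ` (- {V6}))
    = subalgebra hull {Var X6, Var Y6, h6, e6 :: (vars6, 'k) mpoly}"
proof -
  interpret additive_extension "img6 :: vars6 \<Rightarrow> (vars6, 'k) mpoly poly" V6 "Var X6 ^ 2 * Var Y6 ^ 2"
    "subalgebra hull (Var ` (- {V6}))"
    by (rule additive_extension_img6)
  let ?G = "{Var X6, Var Y6, h6, e6 :: (vars6, 'k) mpoly}"
  let ?A = "subalgebra hull (insert (Var S6) ?G)"
  have A: "Var X6 \<in> ?A" "Var Y6 \<in> ?A" "Var S6 \<in> ?A" "h6 \<in> ?A" "e6 \<in> ?A"
    by (auto intro: hull_inc)
  show ?thesis
  proof (rule invariants_Int_S_eq_hull[where w = X6 and s = "Var S6" and e = "Var X6 ^ 3"])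
    show "?G \<subseteq> invariants (hom_of_vars img6)"
      using invariants6_gens[where 'k = 'k] invariants6_gen_char2[OF assms] by simp
    show "?G \<subseteq> subalgebra hull (Var ` (- {V6}))"
      by (auto simp: h6_def e6_def intro!: hull_closed intro: hull_inc)
    have "Var X6 ^ 3 * Var T6 = Var Y6 ^ 3 * Var S6 ^ 2 - (h6 :: (vars6, 'k) mpoly)"
      by (simp add: h6_def)
    also have "\<dots> \<in> ?A" by (intro hull_closed A)
    finally have t: "Var X6 ^ 3 * Var T6 \<in> ?A" .
    have "Var X6 ^ 6 * Var U6 = Var X6 ^ 3 * e6 - Var Y6 ^ 3 * Var S6 * (Var X6 ^ 3 * Var T6 :: (vars6, 'k) mpoly)"
      unfolding e6_def by (simp add: algebra_simps eval_nat_numeral)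
    also have "\<dots> \<in> ?A" by (intro hull_closed A t)
    finally have u: "Var X6 ^ 6 * Var U6 \<in> ?A" .
    have 0: "Var w \<in> ?A \<Longrightarrow> \<exists>n. Var X6 ^ n * Var w \<in> ?A" for w
      by (rule exI[of _ 0]) simp
    show "\<exists>n. Var X6 ^ n * Var w \<in> ?A" if "w \<noteq> V6" for w
      using that 0 A t u by (cases w) auto
    fix g assume "g \<in> subalgebra hull ?G" and van: "\<And>pt. pt X6 = 0 \<Longrightarrow> ev pt g = 0"
    then obtain g0 g1 where g: "g0 \<in> subalgebra hull {Var Y6, h6, e6}"
      "g1 \<in> subalgebra hull ?G" "g = g0 + Var X6 * g1"
      by (auto elim: hull_insert_decomp)
    define gs :: "index3 \<Rightarrow> (vars6, 'k) mpoly" where "gs = case_index3 (Var Y6) h6 e6"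
    have "range gs = {Var Y6, h6, e6}" by (auto simp: gs_def split: index3.splits intro: range_eqI[of _ _ I1] range_eqI[of _ _ I2] range_eqI[of _ _ I3])
    then obtain P where P: "g0 = subst gs P" using g(1) hull_image_Var by metis
    have "P = 0"
    proof (rule mpoly_eq_0I)
      fix q :: "index3 \<Rightarrow> 'k" assume q: "\<And>i. q i \<noteq> 0"
      obtain s where s: "s ^ 2 = q I2 / q I1 ^ 3" using nth_root_exists[of 2] by auto
      have "s \<noteq> 0" using s q by auto
      \<comment> \<open>On \<open>x = 0\<close> the elements \<open>h6\<close> and \<open>e6\<close>
        become \<open>y^3 s^2\<close> and \<open>y^3 s t\<close>, which are solved for
        \<open>s\<close> and \<open>t\<close>.\<close>
      define pt where "pt = case_vars6 0 (q I1) s (q I3 / (q I1 ^ 3 * s)) 0 0"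
      have "ev pt (gs i) = q i" for i
        using q s \<open>s \<noteq> 0\<close> by (cases i) (simp_all add: gs_def h6_def e6_def pt_def)
      then have "ev pt g0 = ev q P" by (simp add: P ev_subst)
      moreover have "pt X6 = 0" by (simp add: pt_def)
      ultimately show "ev q P = 0" using van[of pt] by (simp add: g(3))
    qed
    then show "\<exists>h\<in>subalgebra hull ?G. g = Var X6 * h" using g P by auto
  qed simp_all
qed

text \<open>The syzygy brings every element into the form \<open>a + c6 b\<close> with
  \<open>a\<close>, \<open>b\<close> free of \<open>c6\<close>. On \<open>x = 0\<close> the elements
  \<open>y\<close>, \<open>h6\<close>, \<open>d6\<close> take arbitrary nonzero values and determine
  \<open>s\<close> only up to sign, whereas \<open>c6\<close> becomes \<open>2 y^6 s^3\<close>; both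
  signs together separate \<open>a\<close> from \<open>b\<close>.\<close>

lemma invariants6_S:
  assumes char: "CHAR('k::alg_closed_field) \<noteq> 2"
  shows "invariants (hom_of_vars img6) \<inter> subalgebra hull (Var ` (- {V6}))
    = subalgebra hull {Var X6, Var Y6, h6, c6, d6 :: (vars6, 'k) mpoly}"
proof -
  interpret additive_extension "img6 :: vars6 \<Rightarrow> (vars6, 'k) mpoly poly" V6 "Var X6 ^ 2 * Var Y6 ^ 2"
    "subalgebra hull (Var ` (- {V6}))"
    by (rule additive_extension_img6)
  have two: "2 \<noteq> (0 :: 'k)"
  proof
    assume "2 = (0 :: 'k)"
    then have "of_nat 2 = (0 :: 'k)" by simp
    then have "CHAR('k) dvd 2" by (simp only: of_nat_eq_0_iff_char_dvd)
    then show False using char CHAR_not_1'[where 'a = 'k] dvd_imp_le[of "CHAR('k)" 2] by (cases "CHAR('k)"; cases "CHAR('k) - 1") auto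
  qed
  let ?G = "{Var X6, Var Y6, h6, c6, d6 :: (vars6, 'k) mpoly}"
  let ?A = "subalgebra hull (insert (Var S6) ?G)"
  have A: "Var X6 \<in> ?A" "Var Y6 \<in> ?A" "Var S6 \<in> ?A" "h6 \<in> ?A" "c6 \<in> ?A"
    by (auto intro: hull_inc)
  let ?B = "subalgebra hull {Var X6, Var Y6, h6, d6 :: (vars6, 'k) mpoly}"
  have B: "\<exists>a\<in>?B. \<exists>b\<in>?B. g = a + c6 * b" if "g \<in> subalgebra hull ?G" for g
    using that
  proof (induction rule: subalgebra_hull_induct)
    case (gen g)
    have in_B: "\<exists>a\<in>?B. \<exists>b\<in>?B. g = a + c6 * b" if "g \<in> ?B" for g
      using that by (intro bexI[of _ g] bexI[of _ 0]) (auto intro: hull_closed)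
    from gen consider "g = c6" | "g \<in> ?B" by (auto intro: hull_inc)
    then show ?case
    proof cases
      case 1
      then show ?thesis by (intro bexI[of _ 0] bexI[of _ 1]) (auto intro: hull_closed)
    qed (rule in_B)
  next
    case (const c)
    show ?case by (intro bexI[of _ "Const c"] bexI[of _ 0]) (auto intro: hull_closed)
  next
    case (add g g')
    then obtain a b a' b' where "a \<in> ?B" "b \<in> ?B" "a' \<in> ?B" "b' \<in> ?B" "g = a + c6 * b" "g' = a' + c6 * b'"
      by blast
    then show ?case
      by (intro bexI[of _ "a + a'"] bexI[of _ "b + b'"]) (auto intro: hull_closed simp: algebra_simps)
  next
    case (mult g g')
    then obtain a b a' b' where ab: "a \<in> ?B" "b \<in> ?B" "a' \<in> ?B" "b' \<in> ?B" "g = a + c6 * b" "g' = a' + c6 * b'"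
      by blast
    have "c6 * c6 \<in> ?B" unfolding c6_square by (intro hull_closed hull_inc) auto
    then have "a * a' + c6 * c6 * (b * b') \<in> ?B" "a * b' + b * a' \<in> ?B" using ab by (auto intro!: hull_closed)
    moreover have "g * g' = (a * a' + c6 * c6 * (b * b')) + c6 * (a * b' + b * a')"
      unfolding ab by (simp add: algebra_simps)
    ultimately show ?case by blast
  qed
  show ?thesis
  proof (rule invariants_Int_S_eq_hull[where w = X6 and s = "Var S6" and e = "Var X6 ^ 3"])
    show "?G \<subseteq> invariants (hom_of_vars img6)"
      by (rule invariants6_gens)
    show "?G \<subseteq> subalgebra hull (Var ` (- {V6}))"
      by (auto simp: h6_def c6_def d6_def intro!: hull_closed intro: hull_inc)
    have "Var X6 ^ 3 * Var T6 = Var Y6 ^ 3 * Var S6 ^ 2 - (h6 :: (vars6, 'k) mpoly)"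
      by (simp add: h6_def)
    also have "\<dots> \<in> ?A" by (intro hull_closed A)
    finally have t: "Var X6 ^ 3 * Var T6 \<in> ?A" .
    have "Var X6 ^ 6 * Var U6 = c6 + 3 * Var Y6 ^ 3 * Var S6 * (Var X6 ^ 3 * Var T6)
        - 2 * Var Y6 ^ 6 * (Var S6 :: (vars6, 'k) mpoly) ^ 3"
      unfolding c6_def by (simp add: algebra_simps eval_nat_numeral)
    also have "\<dots> \<in> ?A" by (intro hull_closed A t)
    finally have u: "Var X6 ^ 6 * Var U6 \<in> ?A" .
    have 0: "Var w \<in> ?A \<Longrightarrow> \<exists>n. Var X6 ^ n * Var w \<in> ?A" for w
      by (rule exI[of _ 0]) simp
    show "\<exists>n. Var X6 ^ n * Var w \<in> ?A" if "w \<noteq> V6" for w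
      using that 0 A t u by (cases w) auto
    fix g assume "g \<in> subalgebra hull ?G" and van: "\<And>pt. pt X6 = 0 \<Longrightarrow> ev pt g = 0"
    then obtain a b where ab: "a \<in> ?B" "b \<in> ?B" "g = a + c6 * b" using B by blast
    obtain a0 a1 where a: "a0 \<in> subalgebra hull {Var Y6, h6, d6}" "a1 \<in> ?B" "a = a0 + Var X6 * a1"
      using ab(1) by (rule hull_insert_decomp)
    obtain b0 b1 where b: "b0 \<in> subalgebra hull {Var Y6, h6, d6}" "b1 \<in> ?B" "b = b0 + Var X6 * b1"
      using ab(2) by (rule hull_insert_decomp)
    define gs :: "index3 \<Rightarrow> (vars6, 'k) mpoly" where "gs = case_index3 (Var Y6) h6 d6"
    have "range gs = {Var Y6, h6, d6}" by (auto simp: gs_def split: index3.splits intro: range_eqI[of _ _ I1] range_eqI[of _ _ I2] range_eqI[of _ _ I3])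
    then obtain P Q where PQ: "a0 = subst gs P" "b0 = subst gs Q"
      using a(1) b(1) hull_image_Var by metis
    have "ev q P = 0 \<and> ev q Q = 0" if q: "\<And>i. q i \<noteq> 0" for q :: "index3 \<Rightarrow> 'k"
    proof -
      have 1: "ev q P + 2 * q I1 ^ 6 * s ^ 3 * ev q Q = 0" if s: "s ^ 2 = q I2 / q I1 ^ 3" for s
      proof -
        have "s \<noteq> 0" using s q by auto
        have "4 = (2 * 2 :: 'k)" by simp
        then have four: "4 \<noteq> (0 :: 'k)" using two by (metis mult_eq_0_iff)
        \<comment> \<open>For \<open>x = t = 0\<close> the element \<open>d6\<close> reduces to
          \<open>4 y^6 s^3 u\<close>, which is solved for \<open>u\<close>.\<close>
        define pt where "pt = case_vars6 0 (q I1) s 0 (q I3 / (4 * q I1 ^ 6 * s ^ 3)) 0"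
        have "ev pt (gs i) = q i" for i
          using q s \<open>s \<noteq> 0\<close> four by (cases i) (simp_all add: gs_def h6_def d6_def pt_def)
        then have "ev pt a0 = ev q P" "ev pt b0 = ev q Q" by (simp_all add: PQ ev_subst)
        moreover have "pt X6 = 0" "ev pt c6 = 2 * q I1 ^ 6 * s ^ 3" by (simp_all add: pt_def c6_def)
        ultimately show ?thesis using van[of pt] by (simp add: a(3) b(3) ab(3))
      qed
      obtain s where s: "s ^ 2 = q I2 / q I1 ^ 3" using nth_root_exists[of 2] by auto
      then have s0: "2 * q I1 ^ 6 * s ^ 3 \<noteq> 0" using q two by auto
      let ?z = "2 * q I1 ^ 6 * s ^ 3"
      \<comment> \<open>Replacing \<open>s\<close> by \<open>- s\<close> keeps the values of
        \<open>y\<close>, \<open>h6\<close>, \<open>d6\<close> and negates that of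
        \<open>c6\<close>.\<close>
      have 2: "ev q P + ?z * ev q Q = 0" "ev q P - ?z * ev q Q = 0"
        using 1[OF s] 1[of "- s"] s by simp_all
      then have "2 * (?z * ev q Q) = 0" by algebra
      then have "ev q Q = 0" using two s0 by (metis mult_eq_0_iff)
      then show ?thesis using 2 by simp
    qed
    then have "P = 0" "Q = 0" by (auto intro: mpoly_eq_0I)
    then have "g = Var X6 * (a1 + c6 * b1)" using ab a b PQ by (simp add: algebra_simps)
    moreover have "?B \<subseteq> subalgebra hull ?G" by (rule hull_mono) auto
    then have "a1 + c6 * b1 \<in> subalgebra hull ?G" using a(2) b(2) by (auto intro!: hull_closed intro: hull_inc)
    ultimately show "\<exists>h\<in>subalgebra hull ?G. g = Var X6 * h" by blast
  qed simp_all
qed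

theorem fin_gen_invariants6:
  assumes char: "CHAR('k::alg_closed_field) > 0"
  shows "fin_gen_algebra (invariants (theta6 :: (vars6, 'k) mpoly \<Rightarrow> (vars6, 'k) mpoly poly))"
proof -
  let ?S = "subalgebra hull (Var ` (- {V6})) :: (vars6, 'k) mpoly set"
  interpret additive_extension "img6 :: vars6 \<Rightarrow> (vars6, 'k) mpoly poly" V6 "Var X6 ^ 2 * Var Y6 ^ 2" ?S
    by (rule additive_extension_img6)
  obtain G where G: "finite G" "invariants (hom_of_vars img6) \<inter> ?S = subalgebra hull G"
    using invariants6_S[where 'k = 'k] invariants6_S_char2[where 'k = 'k] by (metis finite.simps)
  have S: "Var w \<in> ?S" if "w \<noteq> V6" for w using that by (auto intro: hull_inc)
  obtain F where "F \<in> polys_over ?S" "lead_coeff F = 1" "degree F > 0"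
    "poly F (Var V6) \<in> invariants (hom_of_vars img6)"
  proof (cases "CHAR('k) = 3")
    case True
    then have three: "3 = (0 :: 'k)" using of_nat_CHAR[where 'a = 'k] by simp
    \<comment> \<open>In characteristic 3, \<open>v^3\<close> gains \<open>x^6 y^6 U^3\<close> and
      \<open>u\<close> gains \<open>x^3 y^6 U^3\<close>, so \<open>v^3 - x^3 u\<close> is
      invariant.\<close>
    let ?F = "[:- (Var X6 ^ 3 * Var U6), 0, 0, 1:] :: (vars6, 'k) mpoly poly"
    show ?thesis
    proof (rule that[of ?F])
      show "?F \<in> polys_over ?S"
        by (auto simp: polys_over_pCons intro!: hull_closed polys_over_0 S)
      show "poly ?F (Var V6) \<in> invariants (hom_of_vars img6)"
      proof (rule invariantI)
        fix l :: 'k and pt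
        have "ev (act img6 l pt) (poly ?F (Var V6)) = ev pt (poly ?F (Var V6))
            + 3 * (pt V6 ^ 2 * (l * pt X6 ^ 2 * pt Y6 ^ 2) + pt V6 * (l * pt X6 ^ 2 * pt Y6 ^ 2) ^ 2
              - l * pt X6 ^ 3 * pt Y6 ^ 3 * pt T6 - l ^ 2 * pt X6 ^ 3 * pt Y6 ^ 6 * pt S6)"
          by (simp add: algebra_simps eval_nat_numeral)
        then show "ev (act img6 l pt) (poly ?F (Var V6)) = ev pt (poly ?F (Var V6))" by (simp add: three)
      qed
    qed simp_all
  next
    case False
    \<comment> \<open>The resulting cubic \<open>x^3 T^3 - 3 y^3 s T^2 + 3 y^3 t T - y^3 u\<close>
      is, at \<open>y = 1\<close>, the binary cubic evaluated at \<open>(T, -1)\<close>; the powers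
      of \<open>y\<close> make the action translate \<open>T\<close> by
      \<open>- l y^3\<close>.\<close>
    let ?r = "[:- Var U6, 3 * Var T6, - 3 * Var S6:] :: (vars6, 'k) mpoly poly"
    show ?thesis
    proof (rule monic_invariant[OF char False refl])
      show "?r \<in> polys_over ?S"
        by (auto simp: polys_over_pCons intro!: hull_closed polys_over_0 S)
      show "map_poly (ev (act img6 l pt)) (monom (Var X6 ^ 3) 3 + smult (Var Y6 ^ 3) ?r)
        = pcompose (map_poly (ev pt) (monom (Var X6 ^ 3) 3 + smult (Var Y6 ^ 3) ?r)) [:- (l * ev pt (Var Y6) ^ 3), 1:]"
        for l :: 'k and pt
        by (simp add: numeral_3_eq_3 monom_Suc monom_0 pcompose_pCons) (simp add: algebra_simps eval_nat_numeral)
    qed (use that invariants6_gens[where 'k = 'k] in \<open>auto simp: S\<close>)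
  qed
  then show ?thesis
    using fin_gen_invariants_of_monic[OF G] unfolding theta6_def by blast
qed

section \<open>Roberts' example\<close>

instance vars7 :: finite
proof
  have "w \<in> range X7 \<union> range Y7 \<union> {V7}" for w by (cases w) auto
  then have "(UNIV :: vars7 set) = range X7 \<union> range Y7 \<union> {V7}" by blast
  moreover have "finite (range X7 \<union> range Y7 \<union> {V7})" by simp
  ultimately show "finite (UNIV :: vars7 set)" by (rule ssubst)
qed

abbreviation S7 :: "(vars7, 'k::comm_ring_1) mpoly set" where
  "S7 \<equiv> subalgebra hull (Var ` (- {V7}))"

definition e7 :: "(vars7, 'k::comm_ring_1) mpoly" where
  "e7 = Var (X7 I1) * Var (X7 I2) * Var (X7 I3)"

text \<open>The increment of \<open>v\<close> is written as \<open>e7\<^sup>2 * 1\<^sup>2\<close> to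
  match the form \<open>e\<^sup>2 * y\<^sup>2\<close> in \<open>monic_invariant\<close>.\<close>

lemma additive_extension_img7:
  "additive_extension (img7 :: vars7 \<Rightarrow> (vars7, 'k::alg_closed_field) mpoly poly) V7 (e7\<^sup>2 * 1\<^sup>2) S7"
proof
  show "lfihd (hom_of_vars (img7 :: vars7 \<Rightarrow> (vars7, 'k) mpoly poly))"
    using lfihd_theta7 by (simp add: theta7_def)
  show "img7 w \<in> polys_over S7" if "w \<noteq> V7" for w
    using that by (cases w) (auto simp: polys_over_pCons intro!: hull_closed polys_over_0 intro: hull_inc)
qed (auto simp: e7_def power_mult_distrib intro!: hull_closed intro: hull_inc)

lemma act_img7 [simp]:
  "act img7 l pt (X7 i) = pt (X7 i)"
  "act img7 l pt (Y7 i) = pt (Y7 i) + l * pt (X7 i) ^ 3"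
  "act img7 l pt V7 = pt V7 + l * (pt (X7 I1) ^ 2 * pt (X7 I2) ^ 2 * pt (X7 I3) ^ 2)"
  by (simp_all add: act_def)

text \<open>Up to sign, the 2 by 2 minors of the matrix with rows \<open>x_i^3\<close> and
  \<open>y_i\<close>. The action adds a multiple of the first row to the second.\<close>

definition minor7 :: "index3 \<Rightarrow> index3 \<Rightarrow> (vars7, 'k::comm_ring_1) mpoly" where
  "minor7 i j = Var (X7 j) ^ 3 * Var (Y7 i) - Var (X7 i) ^ 3 * Var (Y7 j)"

text \<open>Laplace expansion of the 3 by 3 determinant in which the row of the \<open>x_i^3\<close>
  occurs twice.\<close>

lemma minor7_relation:
  "Var (X7 I3) ^ 3 * minor7 I1 I2
    = Var (X7 I2) ^ 3 * minor7 I1 I3 - Var (X7 I1) ^ 3 * minor7 I2 I3"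
  by (simp add: minor7_def algebra_simps)

text \<open>
  Modulo \<open>x\<^sub>1\<close> the relation between the minors lets every element of the ring below be written in
  the monomials \<open>x\<^sub>3\<^sup>i \<Delta>\<^sub>1\<^sub>2\<^sup>j\<close> with \<open>j = 0\<close> or \<open>i < 3\<close>.  At points with \<open>x\<^sub>1 = 0\<close> these are multiples
  of distinct powers \<open>x\<^sub>3\<^sup>i\<^sup>-\<^sup>3\<^sup>j\<close> once \<open>x\<^sub>2\<close>, \<open>\<Delta>\<^sub>1\<^sub>3\<close> and \<open>\<Delta>\<^sub>2\<^sub>3\<close> are fixed.
\<close>

context
  fixes R C :: "(vars7, 'k::alg_closed_field) mpoly set"
    and mon :: "nat \<times> nat \<Rightarrow> (vars7, 'k) mpoly"
    and N :: "(nat \<times> nat) set"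
  defines "R \<equiv> subalgebra hull {Var (X7 I1), Var (X7 I2), Var (X7 I3), minor7 I1 I2, minor7 I1 I3, minor7 I2 I3}"
    and "C \<equiv> subalgebra hull {Var (X7 I2), minor7 I1 I3, minor7 I2 I3}"
    and "mon \<equiv> \<lambda>(i, j). Var (X7 I3) ^ i * minor7 I1 I2 ^ j"
    and "N \<equiv> {(i, j). j = 0 \<or> i < 3}"
begin

text \<open>The elements with a normal form modulo \<open>x1\<close>; stability under multiplication
  by the generators will show that this is all of \<open>R\<close>.\<close>

private definition W :: "(vars7, 'k) mpoly set" where
  "W = {w + Var (X7 I1) * r | w r. w \<in> lin_span C (mon ` N) \<and> r \<in> R}"

private lemma R: "subalgebra R" and C: "subalgebra C" and CR: "C \<subseteq> R"
  and gens: "Var (X7 i) \<in> R" "minor7 I1 I2 \<in> R" "Var (X7 I2) \<in> C" "minor7 I1 I3 \<in> C" "minor7 I2 I3 \<in> C"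
proof -
  show "C \<subseteq> R" unfolding R_def C_def by (rule hull_mono) auto
  show "Var (X7 i) \<in> R" unfolding R_def by (cases i) (auto intro: hull_inc)
qed (auto simp: R_def C_def subalgebra_hull intro: hull_inc)

private lemmas R_closed = subalgebraD[OF R]
private lemmas C_closed = subalgebraD[OF C]

private lemma mon_R: "mon k \<in> R"
  unfolding mon_def by (cases k) (auto intro!: R_closed gens)

private lemma W_add: "a \<in> W \<Longrightarrow> b \<in> W \<Longrightarrow> a + b \<in> W"
proof -
  assume "a \<in> W" "b \<in> W"
  then obtain w r w' r' where "w \<in> lin_span C (mon ` N)" "r \<in> R" "w' \<in> lin_span C (mon ` N)" "r' \<in> R"
    "a = w + Var (X7 I1) * r" "b = w' + Var (X7 I1) * r'" by (auto simp: W_def)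
  then show "a + b \<in> W"
    unfolding W_def by (intro CollectI exI[of _ "w + w'"] exI[of _ "r + r'"])
      (auto simp: algebra_simps intro: lin_span_add R_closed)
qed

private lemma W_multC: "c \<in> C \<Longrightarrow> a \<in> W \<Longrightarrow> c * a \<in> W"
proof -
  assume c: "c \<in> C" and "a \<in> W"
  then obtain w r where "w \<in> lin_span C (mon ` N)" "r \<in> R" "a = w + Var (X7 I1) * r" by (auto simp: W_def)
  then show "c * a \<in> W"
    unfolding W_def using c CR by (intro CollectI exI[of _ "c * w"] exI[of _ "c * r"])
      (auto simp: algebra_simps intro: lin_span_mult subalgebra_imp_unital_subring C R_closed)
qed

private lemma W_x1R: "r \<in> R \<Longrightarrow> Var (X7 I1) * r \<in> W"
  unfolding W_def by (intro CollectI exI[of _ 0] exI[of _ r]) (auto intro: lin_span.zero)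

private lemma W_mon_N: "k \<in> N \<Longrightarrow> mon k \<in> W"
  unfolding W_def using lin_span.step[OF lin_span.zero, of 1 C "mon k" "mon ` N"] C_closed(3) R_closed(2)
  by (intro CollectI exI[of _ "mon k"] exI[of _ 0]) auto

text \<open>Modulo \<open>x1\<close> the relation trades \<open>x3^3 minor12\<close> for
  \<open>x2^3 minor13\<close>, a coefficient in \<open>C\<close>. Each use lowers the exponent of
  \<open>x3\<close> by 3.\<close>

private lemma W_mon: "mon (i, j) \<in> W"
proof (induction i arbitrary: j rule: less_induct)
  case (less i)
  show ?case
  proof (cases "(i, j) \<in> N")
    case False
    then have "3 \<le> i" "j \<noteq> 0" by (auto simp: N_def)
    then obtain i' j' where ij: "i = 3 + i'" "j = Suc j'" using le_Suc_ex not0_implies_Suc by blast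
    have "mon (i, j) = Var (X7 I3) ^ 3 * minor7 I1 I2 * mon (i', j')"
      by (simp only: mon_def ij case_prod_conv power_add power_Suc mult_ac)
    also have "\<dots> = Var (X7 I2) ^ 3 * minor7 I1 I3 * mon (i', j')
        + Var (X7 I1) * (- (Var (X7 I1) ^ 2 * minor7 I2 I3 * mon (i', j')))"
      unfolding minor7_relation by (simp add: algebra_simps eval_nat_numeral)
    also have "\<dots> \<in> W"
      using ij CR by (intro W_add W_multC W_x1R less.IH C_closed gens R_closed mon_R) (auto intro: gens)
    finally show ?thesis .
  qed (rule W_mon_N)
qed

private lemma W_mult_shift:
  assumes "m \<in> {Var (X7 I3), minor7 I1 I2}" "a \<in> W"
  shows "m * a \<in> W"
proof -
  obtain w r where wr: "w \<in> lin_span C (mon ` N)" "r \<in> R" "a = w + Var (X7 I1) * r"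
    using assms(2) by (auto simp: W_def)
  have "m * w \<in> W" using wr(1)
  proof induction
    case zero
    show ?case using W_x1R[OF R_closed(2)] by simp
  next
    case (step x c g)
    then obtain i j where "g = mon (i, j)" by auto
    then have "m * g = mon (Suc i, j) \<or> m * g = mon (i, Suc j)"
      using assms(1) by (auto simp: mon_def mult_ac)
    then have "c * (m * g) + m * x \<in> W" using step W_mon by (metis W_add W_multC)
    then show ?case by (simp add: algebra_simps)
  qed
  moreover have "m \<in> R" using assms(1) gens by auto
  then have "Var (X7 I1) * (m * r) \<in> W" using wr(2) by (intro W_x1R R_closed)
  ultimately have "m * w + Var (X7 I1) * (m * r) \<in> W" by (rule W_add)
  then show ?thesis unfolding wr(3) by (simp add: algebra_simps)
qed

text \<open>Multiplication by each generator preserves \<open>W\<close>, hence so does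
  multiplication by any element of \<open>R\<close>; it is applied to 1, the monomial with index
  \<open>(0, 0)\<close>.\<close>

private lemma R_subset_W: "R \<subseteq> W"
proof
  have WR: "W \<subseteq> R"
  proof -
    have "w \<in> R" if "w \<in> lin_span C (mon ` N)" for w
      using that by induction (use CR in \<open>auto intro!: R_closed mon_R\<close>)
    then show ?thesis by (auto simp: W_def intro!: R_closed gens)
  qed
  fix g assume "g \<in> R"
  then have "\<forall>a\<in>W. g * a \<in> W"
    unfolding R_def
  proof (induction rule: subalgebra_hull_induct)
    case (gen g)
    then consider "g = Var (X7 I1)" | "g \<in> C" | "g \<in> {Var (X7 I3), minor7 I1 I2}"
      using gens by auto
    then show ?case
    proof cases
      case 1
      then show ?thesis using WR W_x1R by auto
    next
      case 2
      then show ?thesis using W_multC by simp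
    next
      case 3
      then show ?thesis using W_mult_shift by simp
    qed
  next
    case (const c)
    then show ?case using W_multC C_closed(1) by blast
  next
    case (add a b)
    then show ?case by (simp add: distrib_right W_add)
  next
    case (mult a b)
    then show ?case by (simp add: mult.assoc)
  qed
  moreover have "mon (0, 0) \<in> W" by (rule W_mon)
  then have "1 \<in> W" by (simp add: mon_def)
  ultimately show "g \<in> W" by fastforce
qed

private lemma span_sum:
  assumes "w \<in> lin_span C (mon ` N)"
  obtains T c where "finite T" "T \<subseteq> N" "\<And>k. c k \<in> C" "w = (\<Sum>k\<in>T. c k * mon k)"
proof -
  \<comment> \<open>Requiring \<open>c\<close> to vanish off \<open>T\<close> lets a further term be
    added in the same way whether or not its index already occurs.\<close>
  have "\<exists>T c. finite T \<and> T \<subseteq> N \<and> (\<forall>k. c k \<in> C) \<and> (\<forall>k. k \<notin> T \<longrightarrow> c k = 0) \<and> w = (\<Sum>k\<in>T. c k * mon k)"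
    using assms
  proof induction
    case zero
    show ?case by (intro exI[of _ "{}"] exI[of _ "\<lambda>_. 0"]) (auto intro: C_closed)
  next
    case (step x r g)
    then obtain T c k where T: "finite T" "T \<subseteq> N" "\<forall>k. c k \<in> C" "\<forall>k. k \<notin> T \<longrightarrow> c k = 0"
      "x = (\<Sum>k\<in>T. c k * mon k)" and k: "k \<in> N" "g = mon k" by blast
    let ?c = "\<lambda>k'. c k' + (if k' = k then r else 0)"
    have "x = (\<Sum>k\<in>insert k T. c k * mon k)"
      unfolding T(5) using T(1,4) by (intro sum.mono_neutral_left) auto
    moreover have "(\<Sum>k'\<in>insert k T. (if k' = k then r else 0) * mon k') = r * g"
      using T(1) k by (simp add: if_distrib[of "\<lambda>z. z * _"] cong: if_cong)
    ultimately have "r * g + x = (\<Sum>k'\<in>insert k T. ?c k' * mon k')"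
      by (simp only: distrib_right sum.distrib add.commute)
    then show ?case using T k step(2)
      by (intro exI[of _ "insert k T"] exI[of _ ?c]) (auto intro: C_closed)
  qed
  then show ?thesis using that by blast
qed

lemma roberts_saturated:
  assumes "g \<in> R" and van: "\<And>pt. pt (X7 I1) = 0 \<Longrightarrow> ev pt g = 0"
  shows "\<exists>h\<in>R. g = Var (X7 I1) * h"
proof -
  obtain w r where wr: "w \<in> lin_span C (mon ` N)" "r \<in> R" "g = w + Var (X7 I1) * r"
    using assms(1) R_subset_W by (auto simp: W_def)
  obtain T c where T: "finite T" "T \<subseteq> N" "\<And>k. c k \<in> C" "w = (\<Sum>k\<in>T. c k * mon k)"
    using span_sum[OF wr(1)] by metis
  define gs :: "index3 \<Rightarrow> (vars7, 'k) mpoly"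
    where "gs = case_index3 (Var (X7 I2)) (minor7 I1 I3) (minor7 I2 I3)"
  have "range gs = {Var (X7 I2), minor7 I1 I3, minor7 I2 I3}"
    by (auto simp: gs_def split: index3.splits intro: range_eqI[of _ _ I1] range_eqI[of _ _ I2] range_eqI[of _ _ I3])
  then have "\<exists>P. c k = subst gs P" for k using T(3)[of k] hull_image_Var unfolding C_def by metis
  then obtain P where P: "\<And>k. c k = subst gs (P k)" by metis
  have "P k0 = 0" if k0: "k0 \<in> T" for k0
  proof (rule mpoly_eq_0I)
    fix q :: "index3 \<Rightarrow> 'k" assume q: "\<And>i. q i \<noteq> 0"
    \<comment> \<open>Multiplying by \<open>z^K\<close> turns the possibly negative exponents
      \<open>i - 3 j\<close> into natural numbers.\<close>
    define K where "K = (\<Sum>k\<in>T. 3 * snd k)"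
    have K: "3 * snd k \<le> K" if "k \<in> T" for k
      unfolding K_def using T(1) that by (intro member_le_sum) auto
    define ex where "ex k = fst k + K - 3 * snd k" for k
    define b where "b k = ev q (P k) * (q I1 ^ 3 * q I2) ^ snd k" for k
    have "(\<Sum>k\<in>T. monom (b k) (ex k)) = 0"
    proof (rule poly_eq_0_infinite)
      fix z :: 'k assume z: "z \<noteq> 0"
      \<comment> \<open>With \<open>x1 = y3 = 0\<close> and \<open>x3 = z\<close>, the prescribed
        values of \<open>minor13\<close> and \<open>minor23\<close> determine \<open>y1\<close> and
        \<open>y2\<close>; \<open>minor12\<close> then takes the value
        \<open>x2^3 minor13 / z^3\<close>.\<close>
      define pt where "pt = case_vars7 (case_index3 0 (q I1) z) (case_index3 (q I2 / z ^ 3) (q I3 / z ^ 3) 0) 0"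
      have "ev pt (gs i) = q i" for i
        using z by (cases i) (simp_all add: gs_def minor7_def pt_def)
      then have ev_c: "ev pt (c k) = ev q (P k)" for k by (simp add: P ev_subst)
      have ev_mon: "z ^ K * ev pt (mon k) = (q I1 ^ 3 * q I2) ^ snd k * z ^ ex k" if "k \<in> T" for k
      proof -
        obtain i j where k: "k = (i, j)" by force
        have "3 * j \<le> K" using K[OF that] by (simp add: k)
        then have "z ^ K = z ^ (K - 3 * j) * z ^ (3 * j)" by (simp flip: power_add)
        moreover have "z ^ ex k = z ^ i * z ^ (K - 3 * j)"
          using \<open>3 * j \<le> K\<close> by (simp add: ex_def k flip: power_add)
        moreover have "ev pt (mon k) = z ^ i * (q I1 ^ 3 * (q I2 / z ^ 3)) ^ j"
          by (simp add: mon_def k minor7_def pt_def)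
        moreover have "(q I1 ^ 3 * (q I2 / z ^ 3)) ^ j * z ^ (3 * j) = (q I1 ^ 3 * q I2) ^ j"
          using z by (simp add: power_mult flip: power_mult_distrib)
        ultimately show ?thesis by (simp add: k mult_ac)
      qed
      have "pt (X7 I1) = 0" by (simp add: pt_def)
      then have "0 = z ^ K * ev pt w" using van[of pt] by (simp add: wr(3))
      also have "\<dots> = (\<Sum>k\<in>T. ev q (P k) * (z ^ K * ev pt (mon k)))"
        by (simp add: T(4) sum_distrib_left ev_c mult_ac)
      also have "\<dots> = poly (\<Sum>k\<in>T. monom (b k) (ex k)) z"
        by (simp add: poly_sum poly_monom ev_mon b_def mult_ac cong: sum.cong)
      finally show "poly (\<Sum>k\<in>T. monom (b k) (ex k)) z = 0" by simp
    qed
    then have "(\<Sum>k\<in>T. coeff (monom (b k) (ex k)) (ex k0)) = 0" by (metis coeff_sum coeff_0)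
    moreover have "(\<Sum>k\<in>T. coeff (monom (b k) (ex k)) (ex k0)) = (\<Sum>k\<in>T. if k = k0 then b k else 0)"
    proof (intro sum.cong refl)
      fix k assume k: "k \<in> T"
      have "k = k0" if e: "ex k = ex k0"
      proof -
        obtain i j i' j' where ij: "k = (i, j)" "k0 = (i', j')" by (metis prod.exhaust)
        have "j = 0 \<or> i < 3" "j' = 0 \<or> i' < 3" using T(2) k k0 by (auto simp: ij N_def)
        then have lt: "j < j' \<Longrightarrow> i' < 3" "j' < j \<Longrightarrow> i < 3" by auto
        have "i + K - 3 * j = i' + K - 3 * j'" "3 * j \<le> K" "3 * j' \<le> K"
          using e K[OF k] K[OF k0] by (simp_all add: ex_def ij)
        then have sum: "i + 3 * j' = i' + 3 * j" by linarith
        \<comment> \<open>For \<open>j < j'\<close> the equation gives \<open>i' \<ge> 3\<close>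
          although \<open>j'\<close> is nonzero, contrary to the choice of \<open>N\<close>; the
          other case is symmetric.\<close>
        then have "j = j'" using lt by (cases j j' rule: linorder_cases) auto
        then show ?thesis using sum by (simp add: ij)
      qed
      then show "coeff (monom (b k) (ex k)) (ex k0) = (if k = k0 then b k else 0)" by auto
    qed
    ultimately have "b k0 = 0" using T(1) k0 by simp
    then show "ev q (P k0) = 0" using q by (simp add: b_def)
  qed
  then have "w = 0" unfolding T(4) by (intro sum.neutral) (simp add: P)
  then show ?thesis using wr by auto
qed

end

text \<open>The slice is \<open>y1\<close>: solving \<open>minor7 I1 i\<close> for
  \<open>y_i\<close> introduces only powers of \<open>x1\<close> as denominators, and
  \<open>roberts_saturated\<close> removes them.\<close>

lemma invariants7_S:
  "invariants (hom_of_vars img7) \<inter> S7 = subalgebra hull {Var (X7 I1), Var (X7 I2), Var (X7 I3),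
    minor7 I1 I2, minor7 I1 I3, minor7 I2 I3 :: (vars7, 'k::alg_closed_field) mpoly}" (is "_ = subalgebra hull ?G")
proof -
  interpret additive_extension "img7 :: vars7 \<Rightarrow> (vars7, 'k) mpoly poly" V7 "e7\<^sup>2 * 1\<^sup>2" S7
    by (rule additive_extension_img7)
  let ?A = "subalgebra hull (insert (Var (Y7 I1)) ?G)"
  have A: "Var (X7 i) \<in> ?A" "Var (Y7 I1) \<in> ?A" "minor7 I1 I2 \<in> ?A" "minor7 I1 I3 \<in> ?A" for i
    by (cases i) (auto intro: hull_inc)
  show ?thesis
  proof (rule invariants_Int_S_eq_hull[where w = "X7 I1" and s = "Var (Y7 I1)" and e = "Var (X7 I1) ^ 3"])
    have "minor7 i j \<in> Inv" for i j
      by (rule invariantI) (simp add: minor7_def algebra_simps)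
    moreover have "Var (X7 i) \<in> Inv" for i by (rule invariantI) simp
    ultimately show "?G \<subseteq> Inv" by simp
    show "?G \<subseteq> S7" by (auto simp: minor7_def intro!: hull_closed intro: hull_inc)
    have y: "Var (X7 I1) ^ 3 * Var (Y7 i) \<in> ?A" for i
    proof -
      have "Var (X7 I1) ^ 3 * Var (Y7 i) = Var (X7 i) ^ 3 * Var (Y7 I1) - (minor7 I1 i :: (vars7, 'k) mpoly)"
        by (simp add: minor7_def)
      moreover have "minor7 I1 I1 = (0 :: (vars7, 'k) mpoly)" by (simp add: minor7_def)
      then have "minor7 I1 i \<in> ?A" using A hull_closed(2) by (cases i) auto
      ultimately show ?thesis using A by (auto intro!: hull_closed)
    qed
    show "\<exists>n. Var (X7 I1) ^ n * Var u \<in> ?A" if "u \<noteq> V7" for u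
    proof (cases u)
      case (X7 i)
      then show ?thesis using A(1)[of i] by (intro exI[of _ 0]) simp
    qed (use that y in auto)
    show "\<exists>h\<in>subalgebra hull ?G. g = Var (X7 I1) * h"
      if "g \<in> subalgebra hull ?G" "\<And>pt. pt (X7 I1) = 0 \<Longrightarrow> ev pt g = 0" for g
      using that by (rule roberts_saturated)
  qed simp_all
qed

theorem fin_gen_invariants7:
  assumes char: "CHAR('k::alg_closed_field) > 0"
  shows "fin_gen_algebra (invariants (theta7 :: (vars7, 'k) mpoly \<Rightarrow> (vars7, 'k) mpoly poly))"
proof -
  interpret additive_extension "img7 :: vars7 \<Rightarrow> (vars7, 'k) mpoly poly" V7 "e7\<^sup>2 * 1\<^sup>2" S7
    by (rule additive_extension_img7)
  have S: "Var w \<in> S7" if "w \<noteq> V7" for w using that by (auto intro: hull_inc)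
  obtain F where "F \<in> polys_over S7" "lead_coeff F = 1" "degree F > 0" "poly F (Var V7) \<in> Inv"
  proof (cases "CHAR('k) = 3")
    case True
    then have three: "3 = (0 :: 'k)" using of_nat_CHAR[where 'a = 'k] by simp
    define x where "x i = (Var (X7 i) :: (vars7, 'k) mpoly)" for i
    define y where "y i = (Var (Y7 i) :: (vars7, 'k) mpoly)" for i
    \<comment> \<open>The bracket is
      \<open>x3^3 y3 minor12^2 + x3^6 y1 y2 (2 x2^3 y1 - x1^3 y2)\<close>. Modulo 3 the terms linear
      in \<open>U\<close> cancel and those in \<open>U^2\<close> vanish, leaving
      \<open>(x1 x2 x3)^6 U^3\<close>, the change of \<open>v^3\<close>.\<close>
    let ?F = "[:- (x I1 ^ 6 * x I3 ^ 3 * y I2 ^ 2 * y I3 - x I1 ^ 3 * x I3 ^ 6 * y I1 * y I2 ^ 2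
      - 2 * (x I1 * x I2 * x I3) ^ 3 * y I1 * y I2 * y I3 + 2 * x I2 ^ 3 * x I3 ^ 6 * y I1 ^ 2 * y I2
      + x I2 ^ 6 * x I3 ^ 3 * y I1 ^ 2 * y I3), 0, 0, 1:]"
    show ?thesis
    proof (rule that[of ?F])
      show "?F \<in> polys_over S7"
        by (auto simp: x_def y_def polys_over_pCons intro!: hull_closed polys_over_0 S)
      show "poly ?F (Var V7) \<in> Inv"
      proof (rule invariantI)
        fix l :: 'k and pt :: "vars7 \<Rightarrow> 'k"
        let ?a = "l * (pt (X7 I1) ^ 2 * pt (X7 I2) ^ 2 * pt (X7 I3) ^ 2)"
        have "ev (act img7 l pt) (poly ?F (Var V7)) = ev pt (poly ?F (Var V7))
            + 3 * (pt V7 ^ 2 * ?a + pt V7 * ?a ^ 2 - pt (X7 I2) ^ 6 * pt (X7 I3) ^ 6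
              * (l * pt (Y7 I1) ^ 2 + l ^ 2 * pt (X7 I1) ^ 3 * pt (Y7 I1)))"
          by (simp add: x_def y_def algebra_simps eval_nat_numeral)
        then show "ev (act img7 l pt) (poly ?F (Var V7)) = ev pt (poly ?F (Var V7))" by (simp add: three)
      qed
    qed simp_all
  next
    case False
    define x where "x i = (Var (X7 i) ^ 3 :: (vars7, 'k) mpoly)" for i
    define y where "y i = (Var (Y7 i) :: (vars7, 'k) mpoly)" for i
    \<comment> \<open>The cubic is the product of the factors \<open>x_i^3 T - y_i\<close>; the
      action translates \<open>T\<close> by \<open>- l\<close> in each of them.\<close>
    let ?r = "[:- (y I1 * y I2 * y I3), x I1 * y I2 * y I3 + x I2 * y I1 * y I3 + x I3 * y I1 * y I2,
      - (x I1 * x I2 * y I3 + x I1 * x I3 * y I2 + x I2 * x I3 * y I1):]"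
    show ?thesis
    proof (rule monic_invariant[OF char False refl])
      show "?r \<in> polys_over S7"
        by (auto simp: x_def y_def polys_over_pCons intro!: hull_closed polys_over_0 S)
      show "map_poly (ev (act img7 l pt)) (monom (e7 ^ 3) 3 + smult (1 ^ 3) ?r)
        = pcompose (map_poly (ev pt) (monom (e7 ^ 3) 3 + smult (1 ^ 3) ?r)) [:- (l * ev pt 1 ^ 3), 1:]"
        for l :: 'k and pt
        by (simp add: x_def y_def e7_def numeral_3_eq_3 monom_Suc monom_0 pcompose_pCons)
          (simp add: algebra_simps eval_nat_numeral)
      show "e7 \<in> S7" by (auto simp: e7_def intro!: hull_closed S)
      show "e7 \<in> Inv" by (rule invariantI) (simp add: e7_def)
      show "1 \<in> S7" "1 \<in> Inv" by (auto intro: hull_closed subalgebraD[OF subalgebra_invariants])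
    qed (use that in \<open>auto simp: e7_def\<close>)
  qed
  then show ?thesis
    using fin_gen_invariants_of_monic[OF _ invariants7_S] unfolding theta7_def by blast
qed

section \<open>The example of Daigle and Freudenburg\<close>

instance vars5 :: finite
proof
  have "(UNIV :: vars5 set) = {X5, S5, T5, U5, V5}" by (auto intro: vars5.exhaust)
  then show "finite (UNIV :: vars5 set)" by (metis finite.simps)
qed

lemma act_img5 [simp]:
  "act img5 l pt X5 = pt X5"
  "act img5 l pt S5 = pt S5 + l * pt X5 ^ 3"
  "act img5 l pt T5 = pt T5 + l * (2 * pt S5 + l * pt X5 ^ 3)"
  "act img5 l pt U5 = pt U5 + l * (3 * pt T5 + l * (3 * pt S5 + l * pt X5 ^ 3))"
  "act img5 l pt V5 = pt V5 + l * pt X5 ^ 2"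
  by (simp_all add: act_def)

definition dehomogenize :: "(vars6, 'k::comm_ring_1) mpoly \<Rightarrow> (vars5, 'k) mpoly" where
  "dehomogenize = subst (case_vars6 (Var X5) 1 (Var S5) (Var T5) (Var U5) (Var V5))"

lemma ev_dehomogenize:
  "ev pt (dehomogenize b) = ev (case_vars6 (pt X5) 1 (pt S5) (pt T5) (pt U5) (pt V5)) b"
  unfolding dehomogenize_def ev_subst
  by (rule arg_cong[of _ _ "\<lambda>f. ev f b"]) (auto split: vars6.split)

text \<open>Rescales a point with \<open>y\<close> nonzero to one with \<open>y = 1\<close>,
  compatibly with the two actions.\<close>

definition affine_chart :: "(vars6 \<Rightarrow> 'k::field) \<Rightarrow> vars5 \<Rightarrow> 'k" where
  "affine_chart pt = case_vars5 (pt X6) (pt S6) (pt T6 / pt Y6 ^ 3) (pt U6 / pt Y6 ^ 6) (pt V6 / pt Y6 ^ 2)"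

text \<open>The weights in \<open>y\<close> are those for which \<open>\<theta>\<^sub>6\<close> is the homogenization of \<open>\<theta>\<^sub>5\<close>.\<close>

lemma homogenization_exists:
  fixes b :: "(vars5, 'k::field) mpoly"
  shows "\<exists>N b'. \<forall>pt. pt Y6 \<noteq> 0 \<longrightarrow> ev pt b' = pt Y6 ^ N * ev (affine_chart pt) b"
proof (induction b rule: mpoly_induct)
  case (1 c)
  show ?case by (intro exI[of _ 0] exI[of _ "Const c"]) simp
next
  case (2 w)
  \<comment> \<open>The largest weight is 6, so this exponent clears the denominators for every
    variable.\<close>
  show ?case
    by (intro exI[of _ 6] exI[of _ "case_vars5 (Var Y6 ^ 6 * Var X6) (Var Y6 ^ 6 * Var S6)
        (Var Y6 ^ 3 * Var T6) (Var U6) (Var Y6 ^ 4 * Var V6) w"], cases w)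
      (simp_all add: affine_chart_def eval_nat_numeral)
next
  case (3 a b)
  then obtain M a' N b' where
    "\<And>pt. pt Y6 \<noteq> 0 \<Longrightarrow> ev pt a' = pt Y6 ^ M * ev (affine_chart pt) a"
    "\<And>pt. pt Y6 \<noteq> 0 \<Longrightarrow> ev pt b' = pt Y6 ^ N * ev (affine_chart pt) b" by blast
  then show ?case
    by (intro exI[of _ "M + N"] exI[of _ "Var Y6 ^ N * a' + Var Y6 ^ M * b'"])
      (simp add: power_add algebra_simps)
next
  case (4 a b)
  then obtain M a' N b' where
    "\<And>pt. pt Y6 \<noteq> 0 \<Longrightarrow> ev pt a' = pt Y6 ^ M * ev (affine_chart pt) a"
    "\<And>pt. pt Y6 \<noteq> 0 \<Longrightarrow> ev pt b' = pt Y6 ^ N * ev (affine_chart pt) b" by blast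
  then show ?case
    by (intro exI[of _ "M + N"] exI[of _ "a' * b'"]) (simp add: power_add algebra_simps)
qed

text \<open>Setting \<open>y = 1\<close> is equivariant and so preserves invariance. Conversely, the
  homogenization of an invariant is invariant, because \<open>y\<close> is fixed and
  \<open>affine_chart\<close> is equivariant, and it specialises back to the given element.\<close>

lemma invariants5_eq_image:
  "invariants (theta5 :: (vars5, 'k::alg_closed_field) mpoly \<Rightarrow> _) = dehomogenize ` invariants theta6"
proof
  show "dehomogenize ` invariants theta6 \<subseteq> invariants (theta5 :: (vars5, 'k) mpoly \<Rightarrow> _)"
  proof
    fix b' assume "b' \<in> dehomogenize ` invariants (theta6 :: (vars6, 'k) mpoly \<Rightarrow> _)"
    then obtain b :: "(vars6, 'k) mpoly" where b: "b \<in> invariants (hom_of_vars img6)" "b' = dehomogenize b"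
      by (auto simp: theta6_def)
    show "b' \<in> invariants theta5"
      unfolding theta5_def
    proof (rule invariantI)
      fix l :: 'k and pt :: "vars5 \<Rightarrow> 'k"
      let ?f = "\<lambda>pt. case_vars6 (pt X5) 1 (pt S5) (pt T5) (pt U5) (pt V5) :: vars6 \<Rightarrow> 'k"
      have "?f (act img5 l pt) = act img6 l (?f pt)"
      proof
        show "?f (act img5 l pt) w = act img6 l (?f pt) w" for w by (cases w) simp_all
      qed
      then show "ev (act img5 l pt) b' = ev pt b'"
        using ev_act_invariant[OF lfihd_theta6[unfolded theta6_def] b(1), of l "?f pt"]
        by (simp add: b(2) ev_dehomogenize)
    qed
  qed
  show "invariants (theta5 :: (vars5, 'k) mpoly \<Rightarrow> _) \<subseteq> dehomogenize ` invariants theta6"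
  proof
    fix b :: "(vars5, 'k) mpoly" assume "b \<in> invariants theta5"
    then have b: "b \<in> invariants (hom_of_vars img5)" by (simp add: theta5_def)
    obtain N b' where b': "\<And>pt. pt Y6 \<noteq> 0 \<Longrightarrow> ev pt b' = pt Y6 ^ N * ev (affine_chart pt) b"
      using homogenization_exists[of b] by blast
    have "b' \<in> invariants (hom_of_vars img6)"
    proof (rule invariantI)
      fix l :: 'k and pt :: "vars6 \<Rightarrow> 'k" assume "\<And>w. pt w \<noteq> 0"
      then have y: "pt Y6 \<noteq> 0" .
      have "affine_chart (act img6 l pt) = act img5 l (affine_chart pt)"
      proof
        show "affine_chart (act img6 l pt) w = act img5 l (affine_chart pt) w" for w
          using y by (cases w) (simp_all add: affine_chart_def field_simps eval_nat_numeral)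
      qed
      then show "ev (act img6 l pt) b' = ev pt b'"
        using y b'[of pt] b'[of "act img6 l pt"]
          ev_act_invariant[OF lfihd_theta5[unfolded theta5_def] b, of l "affine_chart pt"] by simp
    qed
    moreover have "b = dehomogenize b'"
    proof (rule mpoly_eqI_ev)
      fix pt :: "vars5 \<Rightarrow> 'k"
      let ?pt = "case_vars6 (pt X5) 1 (pt S5) (pt T5) (pt U5) (pt V5)"
      have "affine_chart ?pt = pt"
      proof
        show "affine_chart ?pt w = pt w" for w by (cases w) (simp_all add: affine_chart_def)
      qed
      then show "ev pt b = ev pt (dehomogenize b')" using b'[of ?pt] by (simp add: ev_dehomogenize)
    qed
    ultimately show "b \<in> dehomogenize ` invariants theta6" by (auto simp: theta6_def)
  qed
qed

theorem theorem2p1: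
  assumes "CHAR('k::alg_closed_field) > 0"
  shows "fin_gen_algebra (invariants (theta5 :: (vars5, 'k) mpoly \<Rightarrow> (vars5, 'k) mpoly poly))
    \<and> fin_gen_algebra (invariants (theta6 :: (vars6, 'k) mpoly \<Rightarrow> (vars6, 'k) mpoly poly))
    \<and> fin_gen_algebra (invariants (theta7 :: (vars7, 'k) mpoly \<Rightarrow> (vars7, 'k) mpoly poly))"
proof (intro conjI)
  show 6: "fin_gen_algebra (invariants (theta6 :: (vars6, 'k) mpoly \<Rightarrow> (vars6, 'k) mpoly poly))"
    using assms by (rule fin_gen_invariants6)
  then obtain G where "finite G" "subalgebra hull G = invariants (theta6 :: (vars6, 'k) mpoly \<Rightarrow> _)"
    by (auto simp: fin_gen_algebra_def)
  \<comment> \<open>The images of finitely many generators under the substitution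
    \<open>y = 1\<close> generate the image algebra.\<close>
  then show "fin_gen_algebra (invariants (theta5 :: (vars5, 'k) mpoly \<Rightarrow> (vars5, 'k) mpoly poly))"
    unfolding fin_gen_algebra_def invariants5_eq_image dehomogenize_def
    by (intro exI[of _ "subst (case_vars6 (Var X5) 1 (Var S5) (Var T5) (Var U5) (Var V5)) ` G"])
      (simp add: hull_image_subst)
  show "fin_gen_algebra (invariants (theta7 :: (vars7, 'k) mpoly \<Rightarrow> (vars7, 'k) mpoly poly))"
    using assms by (rule fin_gen_invariants7)
qed

end
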